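(* Consider one of the two models (EP) Euler-Poisson or (EE) Einstein-Euler, and let $P\in C^1([0,\infty))$ satisfy $P'>0$ on $(0,\infty)$ and $$\int_0^1\frac{P'(s)}{s}\,ds<\infty\ \text{ (EP)},\qquad\text{respectively}\qquad P\ge0,\ \int_0^1\frac{P'(s)}{s+P(s)}\,ds<\infty\ \text{ (EE)}.$$ Assume in addition that there are constants $c>0$, $\rho_0>0$ and $0<n<3$ such that $$P'(\rho)\le c\,\rho^{1/n}\quad\text{for }\rho\in(0,\rho_0).$$ Let $Q$, $y_{\max}$, $g$, the reduced equation of the model, and the static systems be as given in the context. Then for every $y_0\in(0,y_{\max})$: 1. The reduced equation of the model has a unique solution $y\in C^1([0,\infty))$ with $y(0)=y_0$, and $y$ has a unique zero $R>0$. 2. By $\rho=g(y)$, $p=P(\rho)$ (as functions of $r=|x|$) a static, spherically symmetric solution of the Euler-Poisson, respectively Einstein-Euler, system is defined, where, with $y_\infty:=\lim_{r\to\infty}y(r)$, the potential is $U=y_\infty-y$ for EP, and the metric quantities are $\mu=y_\infty-y$ and $\lambda$ given by $e^{-2\lambda(r)}=1-2m(r)/r$ for EE. 3. This solution is supported in the ball of radius $R$ centered at the origin. 4. $y_0=U(R)-U(0)$ for EP, and $y_0=\mu(R)-\mu(0)$ for EE. 5. $\rho\in C(\mathbb{R}^3)\cap C^1(B_R(0))$, where $B_R(0)$ is the ball of radius $R$ centered at the origin.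
   Context: Notation. $x\in\mathbb{R}^3$, $r=|x|$, $'=d/dr$ for functions of $r$; radial functions of $x$ are identified with functions of $r$. Function $Q$: for $\rho\ge0$, $$Q(\rho)=\int_0^\rho\frac{P'(s)}{s}\,ds\ \text{ (EP)},\qquad Q(\rho)=\int_0^\rho\frac{P'(s)}{s+P(s)}\,ds\ \text{ (EE)}.$$ Set $y_{\max}:=\lim_{\rho\to\infty}Q(\rho)\in(0,\infty]$. Then $Q:[0,\infty)\to[0,y_{\max})$ is a bijection, and $g:(-\infty,y_{\max})\to[0,\infty)$ is defined by $g(y)=Q^{-1}(y)$ for $0<y<y_{\max}$ and $g(y)=0$ for $y\le0$. Mass function: $m(r)=4\pi\int_0^r s^2g(y(s))\,ds$. Reduced equations (the right hand sides are understood as their limit $0$ at $r=0$; solutions take values in $(-\infty,y_{\max})$): EP: $y'(r)=-\dfrac{m(r)}{r^2}$. EE: $y'(r)=-\dfrac{1}{1-2m(r)/r}\left(\dfrac{m(r)}{r^2}+4\pi r\,p(r)\right)$ with $p(r)=P(g(y(r)))$, where being a solution includes $2m(r)<r$ for all $r>0$. Static systems: EP: $\nabla p+\rho\nabla U=0$, $p=P(\rho)$, $\Delta U=4\pi\rho$ on $\mathbb{R}^3$, $\lim_{|x|\to\infty}U(x)=0$. EE: $\nabla p+(p+\rho)\nabla\mu=0$, $p=P(\rho)$, together with the field equations $e^{-2\lambda}(2r\lambda'-1)+1=8\pi r^2\rho$ and $e^{-2\lambda}(2r\mu'+1)-1=8\pi r^2p$, and the boundary conditions $\lim_{r\to\infty}\mu(r)=\lim_{r\to\infty}\lambda(r)=0$,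 $\lambda(0)=0$. (The metric is $ds^2=-e^{2\mu}dt^2+e^{2\lambda}dr^2+r^2(d\theta^2+\sin^2\theta\,d\varphi^2)$.)
   Formalization: For EE the formal theorem also assumes P(0)=0; if P(0)>0 (e.g. P(s)=1+s^2) then y'≤-4πrP(0), so y→-∞ and y_∞, μ do not exist. For EP with P(0)≠0, "supported in the ball" is asserted for ρ only, since p equals P(0) in vacuum. *)

theory Defs
  imports "HOL-Analysis.Analysis"
begin

text \<open>EP: Euler-Poisson, EE: Einstein-Euler.\<close>

datatype model = EP | EE

text \<open>Throughout, \<open>P'\<close> is the derivative of the equation of state \<open>P\<close>; both matter only on
  \<open>[0,\<infinity>)\<close>, with a one-sided derivative at \<open>0\<close>.\<close>

definition C1_halfline :: "(real \<Rightarrow> real) \<Rightarrow> (real \<Rightarrow> real) \<Rightarrow> bool" where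
  "C1_halfline f f' \<longleftrightarrow>
     (\<forall>r\<ge>0. (f has_real_derivative f' r) (at r within {0..})) \<and> continuous_on {0..} f'"

fun Q_integrand :: "model \<Rightarrow> (real \<Rightarrow> real) \<Rightarrow> (real \<Rightarrow> real) \<Rightarrow> real \<Rightarrow> real" where
  "Q_integrand EP P P' s = P' s / s"
| "Q_integrand EE P P' s = P' s / (s + P s)"

text \<open>The integrand is positive on \<open>(0,\<infinity>)\<close> in all uses, so the Henstock-Kurzweil integral here is
  the Lebesgue integral; the value of the integrand at the possible singularity \<open>s = 0\<close> is
  irrelevant.\<close>

definition Q :: "model \<Rightarrow> (real \<Rightarrow> real) \<Rightarrow> (real \<Rightarrow> real) \<Rightarrow> real \<Rightarrow> real" where
  "Q M P P' \<rho> = integral {0..\<rho>} (Q_integrand M P P')"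

definition y_max :: "model \<Rightarrow> (real \<Rightarrow> real) \<Rightarrow> (real \<Rightarrow> real) \<Rightarrow> ereal" where
  "y_max M P P' = Lim at_top (\<lambda>\<rho>. ereal (Q M P P' \<rho>))"

definition g :: "model \<Rightarrow> (real \<Rightarrow> real) \<Rightarrow> (real \<Rightarrow> real) \<Rightarrow> real \<Rightarrow> real" where
  "g M P P' y = (if y \<le> 0 then 0 else the_inv_into {0..} (Q M P P') y)"

definition mass :: "model \<Rightarrow> (real \<Rightarrow> real) \<Rightarrow> (real \<Rightarrow> real) \<Rightarrow> (real \<Rightarrow> real) \<Rightarrow> real \<Rightarrow> real" where
  "mass M P P' y r = 4 * pi * integral {0..r} (\<lambda>s. s\<^sup>2 * g M P P' (y s))"

fun reduced_rhs ::
  "model \<Rightarrow> (real \<Rightarrow> real) \<Rightarrow> (real \<Rightarrow> real) \<Rightarrow> (real \<Rightarrow> real) \<Rightarrow> real \<Rightarrow> real" where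
  "reduced_rhs EP P P' y r = (if r = 0 then 0 else - mass EP P P' y r / r\<^sup>2)"
| "reduced_rhs EE P P' y r = (if r = 0 then 0 else
     - (1 / (1 - 2 * mass EE P P' y r / r)) *
       (mass EE P P' y r / r\<^sup>2 + 4 * pi * r * P (g EE P P' (y r))))"

definition reduced_solution ::
  "model \<Rightarrow> (real \<Rightarrow> real) \<Rightarrow> (real \<Rightarrow> real) \<Rightarrow> real \<Rightarrow> (real \<Rightarrow> real) \<Rightarrow> bool" where
  "reduced_solution M P P' y0 y \<longleftrightarrow>
     C1_halfline y (reduced_rhs M P P' y) \<and>
     y 0 = y0 \<and>
     (\<forall>r\<ge>0. ereal (y r) < y_max M P P') \<and>
     (M = EE \<longrightarrow> (\<forall>r>0. 2 * mass M P P' y r < r))"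

definition gradient :: "(real^3 \<Rightarrow> real) \<Rightarrow> real^3 \<Rightarrow> real^3" where
  "gradient f x = (\<chi> i. frechet_derivative f (at x) (axis i 1))"

text \<open>\<open>C1_on\<close> and \<open>C2_on\<close> are meant for open sets only.\<close>

definition C1_on :: "(real^3) set \<Rightarrow> (real^3 \<Rightarrow> real) \<Rightarrow> bool" where
  "C1_on S f \<longleftrightarrow> (\<forall>x\<in>S. f differentiable (at x)) \<and> continuous_on S (gradient f)"

definition C2_on :: "(real^3) set \<Rightarrow> (real^3 \<Rightarrow> real) \<Rightarrow> bool" where
  "C2_on S f \<longleftrightarrow> C1_on S f \<and> (\<forall>i. C1_on S (\<lambda>x. gradient f x $ i))"

definition laplacian :: "(real^3 \<Rightarrow> real) \<Rightarrow> real^3 \<Rightarrow> real" where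
  "laplacian f x = (\<Sum>i\<in>UNIV. gradient (\<lambda>z. gradient f z $ i) x $ i)"

definition spherically_symmetric :: "(real^3 \<Rightarrow> real) \<Rightarrow> bool" where
  "spherically_symmetric f \<longleftrightarrow> (\<forall>A x. orthogonal_transformation A \<longrightarrow> f (A x) = f x)"

definition static_Euler_Poisson ::
  "(real \<Rightarrow> real) \<Rightarrow> (real^3 \<Rightarrow> real) \<Rightarrow> (real^3 \<Rightarrow> real) \<Rightarrow> (real^3 \<Rightarrow> real) \<Rightarrow> bool" where
  "static_Euler_Poisson P \<rho> p U \<longleftrightarrow>
     C1_on UNIV p \<and> C2_on UNIV U \<and>
     (\<forall>x. \<rho> x \<ge> 0 \<and> p x = P (\<rho> x)) \<and>
     (\<forall>x. gradient p x + \<rho> x *\<^sub>R gradient U x = 0) \<and>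
     (\<forall>x. laplacian U x = 4 * pi * \<rho> x) \<and>
     (U \<longlongrightarrow> 0) at_infinity"

text \<open>The spherically symmetric Einstein-Euler system in Schwarzschild coordinates: \<open>\<rho>\<close>, \<open>p\<close>, \<open>\<mu>\<close>
  and \<open>lam\<close> are the radial profiles, and the gradients are those of the corresponding radial
  functions on \<open>\<real>\<^sup>3\<close>. The field equations and the limits at infinity leave no room for a positive
  pressure \<open>P 0\<close> in vacuum, so compactly supported solutions can exist only if \<open>P 0 = 0\<close>.\<close>

definition static_Einstein_Euler ::
  "(real \<Rightarrow> real) \<Rightarrow> (real \<Rightarrow> real) \<Rightarrow> (real \<Rightarrow> real) \<Rightarrow> (real \<Rightarrow> real) \<Rightarrow> (real \<Rightarrow> real) \<Rightarrow> bool" where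
  "static_Einstein_Euler P \<rho> p \<mu> lam \<longleftrightarrow>
     C1_on UNIV (\<lambda>x. p (norm x)) \<and> C1_on UNIV (\<lambda>x. \<mu> (norm x)) \<and>
     (\<forall>r\<ge>0. \<rho> r \<ge> 0 \<and> p r = P (\<rho> r)) \<and>
     (\<forall>x. gradient (\<lambda>z. p (norm z)) x +
           (p (norm x) + \<rho> (norm x)) *\<^sub>R gradient (\<lambda>z. \<mu> (norm z)) x = 0) \<and>
     (\<exists>\<mu>' lam'. C1_halfline \<mu> \<mu>' \<and> C1_halfline lam lam' \<and>
        (\<forall>r\<ge>0. exp (- 2 * lam r) * (2 * r * lam' r - 1) + 1 = 8 * pi * r\<^sup>2 * \<rho> r) \<and>
        (\<forall>r\<ge>0. exp (- 2 * lam r) * (2 * r * \<mu>' r + 1) - 1 = 8 * pi * r\<^sup>2 * p r)) \<and>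
     (\<mu> \<longlongrightarrow> 0) at_top \<and> (lam \<longlongrightarrow> 0) at_top \<and> lam 0 = 0"

end

theory Submission
  imports Defs
begin

text \<open>Both reduced equations are the case \<open>k = 0\<close> or \<open>k = 1\<close> of one equation
  \<open>y' = - (m / r\<^sup>2 + 4 \<pi> r p) / (1 - 2 k m / r)\<close>. As long as the density is kept above a positive
  level and the denominator is cut off from below, the right hand side is a Lipschitz causal operator,
  so Banach's fixed point theorem in a weighted norm applies. Because \<open>y\<close> decreases, the
  solutions for two cut-off levels differ after truncation by at most the larger level, which gives
  existence and uniqueness in the limit. The function \<open>y - ln (1 - 2 k m / r) / 4\<close> is
  nonincreasing, which keeps the denominator away from \<open>0\<close>. Finally \<open>n < 3\<close> forces a zero of
  \<open>y\<close>: otherwise \<open>y\<close> would decay faster than the \<open>1 / r\<close> that its mass permits.\<close>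

subsection \<open>Calculus on the half-line\<close>

text \<open>The obstacle is the vacuum boundary. For positive \<open>y\<close> the slope of
  \<open>g\<close> is \<open>(\<rho> + p) / P' \<rho>\<close> at \<open>\<rho> = g y\<close>
  (without \<open>p\<close> for EP), and it may blow up as \<open>y\<close> tends to
  \<open>0\<close>: if \<open>P'\<close> is \<open>s powr (1 / n)\<close> near \<open>0\<close>,
  then \<open>g y\<close> behaves like a multiple of \<open>y powr n\<close>, which is not Lipschitz
  for \<open>n < 1\<close>. Picard iteration thus fails exactly where the star ends, and the
  regularised solutions must be compared through monotonicity instead of a Lipschitz constant. The
  pressure behaves better: in \<open>P (g y)\<close> the factor \<open>P'\<close> cancels and leaves
  the derivative \<open>\<rho> + p\<close>, continuous across \<open>0\<close>. So the pressure is
  C1 on all of space, the density only inside the open ball. The second obstacle is relativistic: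
  the equation does not visibly prevent \<open>2 m / r\<close> from approaching \<open>1\<close>.
  The bound against this has to hold for every true solution and not only for the constructed one,
  since otherwise uniqueness would cover only solutions that stay away from the cut-off.\<close>

lemma at_within_halfline: "at r within {0..} = at r" if "0 < r" for r :: real
  using that by (intro at_within_interior) simp

lemma at_within_halfline_Icc: "at r within {0..} = at r within {0..b}"
  if "r < b" for r b :: real
  using that by (intro at_within_nhd[of r "{..<b}"]) auto

lemma DERIV_integral_halfline:
  fixes f :: "real \<Rightarrow> real"
  assumes "continuous_on {0..} f" "0 \<le> r"
  shows "((\<lambda>u. integral {0..u} f) has_real_derivative f r) (at r within {0..})"
proof -
  have "continuous_on {0..r+1} f"
    using assms(1) by (rule continuous_on_subset) auto
  from integral_has_real_derivative[OF this, of r] show ?thesis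
    using assms(2) at_within_halfline_Icc[of r "r+1"] by simp
qed

lemma continuous_on_integral_halfline:
  fixes f :: "real \<Rightarrow> real"
  assumes "continuous_on {0..} f"
  shows "continuous_on {0..} (\<lambda>u. integral {0..u} f)"
  by (rule DERIV_continuous_on[where D = f]) (use DERIV_integral_halfline[OF assms] in auto)

lemma integrable_halfline:
  fixes f :: "real \<Rightarrow> real"
  assumes "continuous_on {0..} f"
  shows "f integrable_on {0..r}"
  by (intro integrable_continuous_real continuous_on_subset[OF assms]) auto

lemma integral_DERIV_halfline:
  fixes f f' :: "real \<Rightarrow> real"
  assumes "\<And>r. 0 \<le> r \<Longrightarrow> (f has_real_derivative f' r) (at r within {0..})" "0 \<le> b"
  shows "(f' has_integral f b - f 0) {0..b}"
proof (rule fundamental_theorem_of_calculus[OF assms(2)])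
  fix x assume "x \<in> {0..b}"
  then have "(f has_real_derivative f' x) (at x within {0..b})"
    by (intro DERIV_subset[OF assms(1)]) auto
  then show "(f has_vector_derivative f' x) (at x within {0..b})"
    by (simp add: has_real_derivative_iff_has_vector_derivative)
qed

lemma nonincreasing_Icc:
  fixes f :: "real \<Rightarrow> real"
  assumes "\<And>r. a < r \<Longrightarrow> r < b \<Longrightarrow> \<exists>d. (f has_real_derivative d) (at r) \<and> d \<le> 0"
    and "continuous_on {a..b} f" and "a \<le> b"
  shows "f b \<le> f a"
  using assms DERIV_nonpos_imp_decreasing_open by blast

text \<open>The bound at \<open>r = 0\<close> forces \<open>f 0 = 0\<close>, which is the value that
  division by zero gives to quotients such as mass over \<open>r\<^sup>2\<close>. The linear
  estimate supplies the matching limit at the center.\<close>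

lemma continuous_on_halfline_vanishing:
  fixes f :: "real \<Rightarrow> real"
  assumes cont: "continuous_on {0<..} f"
    and bound: "\<And>r. 0 \<le> r \<Longrightarrow> r < 1 \<Longrightarrow> \<bar>f r\<bar> \<le> C * r"
  shows "continuous_on {0..} f"
proof (rule continuous_on_eq_continuous_within[THEN iffD2], rule ballI)
  fix r :: real assume "r \<in> {0..}"
  then consider "r = 0" | "0 < r" by fastforce
  then show "continuous (at r within {0..}) f"
  proof cases
    case 1
    have "f 0 = 0" using bound[of 0] by simp
    moreover have "(f \<longlongrightarrow> 0) (at 0 within {0..})"
    proof (rule Lim_null_comparison)
      show "\<forall>\<^sub>F x in at 0 within {0..}. norm (f x) \<le> C * x"
        using bound by (auto simp: eventually_at dist_real_def intro!: exI[of _ 1])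
      show "((\<lambda>x. C * x) \<longlongrightarrow> 0) (at 0 within {0..})"
        by (auto intro!: tendsto_eq_intros)
    qed
    ultimately show ?thesis using 1 by (simp add: continuous_within)
  next
    case 2
    then have "isCont f r" using cont continuous_on_eq_continuous_at[OF open_greaterThan] by blast
    then show ?thesis by (rule continuous_at_imp_continuous_within)
  qed
qed

lemma nonincreasing_bounded_convergent:
  fixes f :: "real \<Rightarrow> real"
  assumes dec: "\<And>r s. 0 \<le> r \<Longrightarrow> r \<le> s \<Longrightarrow> f s \<le> f r" and bound: "\<And>r. 0 \<le> r \<Longrightarrow> b \<le> f r"
  shows "\<exists>l. (f \<longlongrightarrow> l) at_top"
proof -
  have bdd: "bdd_below (f ` {0..})" using bound by (auto simp: bdd_below_def)
  have "(f \<longlongrightarrow> Inf (f ` {0..})) at_top"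
  proof (rule order_tendstoI)
    fix x assume "x < Inf (f ` {0..})"
    then show "\<forall>\<^sub>F r in at_top. x < f r"
      using cINF_lower[OF bdd] by (intro eventually_at_top_linorderI[of 0]) (auto intro: less_le_trans)
  next
    fix x assume "Inf (f ` {0..}) < x"
    then obtain r where "0 \<le> r" "f r < x" using cInf_lessD[of "f ` {0..}" x] by auto
    then show "\<forall>\<^sub>F r in at_top. f r < x"
      using dec by (intro eventually_at_top_linorderI[of r]) (auto intro: le_less_trans)
  qed
  then show ?thesis by blast
qed

subsection \<open>Volterra equations\<close>

text \<open>\<open>\<Phi>\<close> is causal: its difference at \<open>r\<close> is controlled by the
  differences on \<open>[0, r]\<close>. The Lipschitz factor \<open>w r\<close> may grow without
  bound in \<open>r\<close>; its primitive \<open>W\<close> is what the weight of the norm is built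
  from. The same \<open>w\<close> bounds the size of \<open>\<Phi>\<close>, so that the integral
  operator maps into a weighted space of bounded functions.\<close>

locale volterra =
  fixes \<Phi> :: "(real \<Rightarrow> real) \<Rightarrow> real \<Rightarrow> real" and w W :: "real \<Rightarrow> real" and a :: real
  assumes \<Phi>_cont: "\<And>y. continuous_on {0..} y \<Longrightarrow> continuous_on {0..} (\<Phi> y)"
    and \<Phi>_bound: "\<And>y r. continuous_on {0..} y \<Longrightarrow> 0 \<le> r \<Longrightarrow> \<bar>\<Phi> y r\<bar> \<le> w r"
    and \<Phi>_lip: "\<And>y z r D. continuous_on {0..} y \<Longrightarrow> continuous_on {0..} z \<Longrightarrow> 0 \<le> r \<Longrightarrow>
          (\<And>s. 0 \<le> s \<Longrightarrow> s \<le> r \<Longrightarrow> \<bar>y s - z s\<bar> \<le> D) \<Longrightarrow> \<bar>\<Phi> y r - \<Phi> z r\<bar> \<le> w r * D"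
    and W_deriv: "\<And>r. 0 \<le> r \<Longrightarrow> (W has_real_derivative w r) (at r within {0..})"
    and W_0: "W 0 = 0"
    and w_nonneg: "\<And>r. 0 \<le> r \<Longrightarrow> 0 \<le> w r"
begin

lemma W_mono: "0 \<le> r \<Longrightarrow> r \<le> s \<Longrightarrow> W r \<le> W s"
proof -
  assume r: "0 \<le> r" "r \<le> s"
  have "continuous_on {0..} W"
    by (rule DERIV_continuous_on[where D = w]) (use W_deriv in auto)
  then have "continuous_on {r..s} W" by (rule continuous_on_subset) (use r in auto)
  moreover have "\<exists>d. (W has_real_derivative d) (at x) \<and> 0 \<le> d" if "r < x" for x
    using W_deriv[of x] w_nonneg[of x] that r at_within_halfline[of x] by auto
  ultimately show "W r \<le> W s"
    using r by (intro DERIV_nonneg_imp_increasing_open[of r s W]) auto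
qed

lemma W_nonneg: "0 \<le> r \<Longrightarrow> 0 \<le> W r"
  using W_mono[of 0 r] W_0 by simp

lemma continuous_on_W: "continuous_on {0..} W"
  by (rule DERIV_continuous_on[where D = w]) (use W_deriv in auto)

text \<open>The weight \<open>exp (2 * W r)\<close> turns the integral operator into a contraction with
  constant \<open>1/2\<close>.\<close>

lemma integral_contraction:
  assumes y: "continuous_on {0..} y" and z: "continuous_on {0..} z" and r: "0 \<le> r"
    and D: "\<And>s. 0 \<le> s \<Longrightarrow> s \<le> r \<Longrightarrow> \<bar>y s - z s\<bar> \<le> D * exp (2 * W s)" and "0 \<le> D"
  shows "\<bar>integral {0..r} (\<Phi> y) - integral {0..r} (\<Phi> z)\<bar> \<le> D / 2 * exp (2 * W r)"
proof -
  have I: "((\<lambda>s. w s * (D * exp (2 * W s))) has_integral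
      D / 2 * exp (2 * W r) - D / 2 * exp (2 * W 0)) {0..r}"
    by (rule integral_DERIV_halfline[OF _ r]) (auto intro!: derivative_eq_intros W_deriv)
  have "\<bar>integral {0..r} (\<Phi> y) - integral {0..r} (\<Phi> z)\<bar> = norm (integral {0..r} (\<lambda>s. \<Phi> y s - \<Phi> z s))"
    by (simp add: integral_diff integrable_halfline[OF \<Phi>_cont] y z)
  also have "\<dots> \<le> integral {0..r} (\<lambda>s. w s * (D * exp (2 * W s)))"
  proof (rule integral_norm_bound_integral)
    fix s assume s: "s \<in> {0..r}"
    \<comment> \<open>\<open>\<Phi>_lip\<close> asks for one constant on all of
      \<open>[0, s]\<close>; since \<open>W\<close> increases, the weighted bound at the right end
      serves.\<close>
    have "\<bar>y u - z u\<bar> \<le> D * exp (2 * W s)" if "0 \<le> u" "u \<le> s" for u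
    proof -
      have "D * exp (2 * W u) \<le> D * exp (2 * W s)"
        using W_mono[of u s] that \<open>0 \<le> D\<close> by (intro mult_left_mono) auto
      then show ?thesis using D[of u] that s by simp
    qed
    then show "norm (\<Phi> y s - \<Phi> z s) \<le> w s * (D * exp (2 * W s))"
      using \<Phi>_lip[OF y z] s by auto
  qed (use I in \<open>auto intro!: integrable_diff integrable_halfline[OF \<Phi>_cont] y z\<close>)
  also have "\<dots> \<le> D / 2 * exp (2 * W r)"
    using I \<open>0 \<le> D\<close> W_0 by (simp add: integral_unique)
  finally show ?thesis .
qed

lemma integral_bound:
  assumes y: "continuous_on {0..} y" and r: "0 \<le> r"
  shows "\<bar>integral {0..r} (\<Phi> y)\<bar> \<le> W r"
proof -
  have I: "(w has_integral W r - W 0) {0..r}"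
    by (rule integral_DERIV_halfline[OF _ r]) (rule W_deriv)
  have "norm (integral {0..r} (\<Phi> y)) \<le> integral {0..r} w"
    by (rule integral_norm_bound_integral)
      (use I in \<open>auto intro!: integrable_halfline[OF \<Phi>_cont] y \<Phi>_bound\<close>)
  then show ?thesis using I W_0 by (simp add: integral_unique)
qed

text \<open>The weighted difference \<open>q\<close> attains a maximum on the interval, and the
  contraction at the maximiser gives \<open>q t \<le> q t / 2\<close>. The statement is local
  because the solutions for two cut-off levels satisfy the same equation only up to some
  radius.\<close>

lemma unique_on_interval:
  assumes y: "continuous_on {0..} y" and z: "continuous_on {0..} z" and b: "0 \<le> b"
    and ye: "\<And>r. 0 \<le> r \<Longrightarrow> r \<le> b \<Longrightarrow> y r = a + integral {0..r} (\<Phi> y)"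
    and ze: "\<And>r. 0 \<le> r \<Longrightarrow> r \<le> b \<Longrightarrow> z r = a + integral {0..r} (\<Phi> z)"
    and r: "0 \<le> r" "r \<le> b"
  shows "y r = z r"
proof -
  define q where "q s = \<bar>y s - z s\<bar> * exp (- 2 * W s)" for s
  have "continuous_on {0..} q"
    unfolding q_def by (intro continuous_intros y z continuous_on_W)
  then have "continuous_on {0..b} q" by (rule continuous_on_subset) auto
  then obtain t where t: "t \<in> {0..b}" "\<And>s. s \<in> {0..b} \<Longrightarrow> q s \<le> q t"
    using continuous_attains_sup[of "{0..b}" q] b by auto
  have abs_eq: "\<bar>y s - z s\<bar> = q s * exp (2 * W s)" for s
    by (simp add: q_def mult.assoc flip: exp_add)
  have "\<bar>y t - z t\<bar> \<le> q t / 2 * exp (2 * W t)"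
    using t ye[of t] ze[of t] integral_contraction[OF y z, of t "q t"]
    by (auto simp: abs_eq) (simp add: q_def)
  then have "q t \<le> 0" by (simp add: abs_eq mult_le_0_iff)
  then have "q r \<le> 0" using t(2)[of r] r by auto
  then show ?thesis by (simp add: q_def mult_le_0_iff)
qed

text \<open>The unknown is the rescaled deviation \<open>(y - a) * exp (- 2 * W)\<close>, an element
  of the Banach space of bounded continuous functions; \<open>ext\<close> undoes the rescaling. As
  these functions live on the whole line, \<open>T0\<close> clamps its argument with
  \<open>max 0\<close>. Boundedness by \<open>1\<close> comes from
  \<open>W \<le> exp (2 * W)\<close>.\<close>

lemma solution_exists:
  "\<exists>y. continuous_on {0..} y \<and> (\<forall>r\<ge>0. y r = a + integral {0..r} (\<Phi> y))"
proof -
  define ext :: "(real \<Rightarrow>\<^sub>C real) \<Rightarrow> real \<Rightarrow> real"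
    where "ext f r = a + exp (2 * W r) * f r" for f r
  define T0 where "T0 f r = exp (- 2 * W (max 0 r)) * integral {0..max 0 r} (\<Phi> (ext f))" for f r
  have ext_cont: "continuous_on {0..} (ext f)" for f
    unfolding ext_def by (intro continuous_intros continuous_on_W) auto
  have T0_cont: "continuous_on UNIV (T0 f)" for f
  proof -
    have "continuous_on {0..} (\<lambda>r. exp (- 2 * W r) * integral {0..r} (\<Phi> (ext f)))"
      by (intro continuous_intros continuous_on_W continuous_on_integral_halfline \<Phi>_cont ext_cont)
    then have "continuous_on UNIV ((\<lambda>r. exp (- 2 * W r) * integral {0..r} (\<Phi> (ext f))) \<circ> max 0)"
      by (intro continuous_on_compose) (auto intro!: continuous_intros elim!: continuous_on_subset)
    then show ?thesis by (simp add: T0_def o_def)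
  qed
  have T0_bound: "norm (T0 f r) \<le> 1" for f r
  proof -
    have "\<bar>integral {0..max 0 r} (\<Phi> (ext f))\<bar> \<le> W (max 0 r)"
      by (rule integral_bound[OF ext_cont]) simp
    also have "\<dots> \<le> exp (2 * W (max 0 r))"
      using W_nonneg[of "max 0 r"] exp_ge_add_one_self[of "2 * W (max 0 r)"] by linarith
    finally show ?thesis
      by (simp add: T0_def abs_mult exp_minus field_simps)
  qed
  define T where "T f = Bcontfun (T0 f)" for f
  have T_app: "apply_bcontfun (T f) = T0 f" for f
    unfolding T_def by (rule Bcontfun_inverse) (rule bcontfun_normI[OF T0_cont T0_bound])
  have "dist (T f) (T h) \<le> (1/2) * dist f h" for f h
  proof (rule dist_bound)
    fix x :: real
    define u where "u = max 0 x"
    have "\<bar>integral {0..u} (\<Phi> (ext f)) - integral {0..u} (\<Phi> (ext h))\<bar> \<le> dist f h / 2 * exp (2 * W u)"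
    proof (rule integral_contraction[OF ext_cont ext_cont])
      fix s :: real
      have "\<bar>ext f s - ext h s\<bar> = \<bar>f s - h s\<bar> * exp (2 * W s)"
        by (simp add: ext_def abs_mult flip: right_diff_distrib)
      then show "\<bar>ext f s - ext h s\<bar> \<le> dist f h * exp (2 * W s)"
        using dist_bounded[of f s h] by (simp add: dist_real_def)
    qed (auto simp: u_def)
    then have "exp (- 2 * W u) * \<bar>integral {0..u} (\<Phi> (ext f)) - integral {0..u} (\<Phi> (ext h))\<bar> \<le>
        exp (- 2 * W u) * (dist f h / 2 * exp (2 * W u))"
      by (intro mult_left_mono) auto
    also have "\<dots> = dist f h / 2"
      by (simp add: exp_minus field_simps)
    finally show "dist (T f x) (T h x) \<le> (1/2) * dist f h"
      by (simp add: T_app T0_def dist_real_def u_def abs_mult flip: right_diff_distrib)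
  qed
  then obtain f where f: "T f = f"
    using banach_fix_type[of "1/2" T] by auto
  have "ext f r = a + integral {0..r} (\<Phi> (ext f))" if "0 \<le> r" for r
  proof -
    have "f r = exp (- 2 * W r) * integral {0..r} (\<Phi> (ext f))"
      using T_app[of f] that by (simp add: f T0_def)
    then show ?thesis
      by (simp add: ext_def[of f r] exp_minus)
  qed
  then show ?thesis using ext_cont by blast
qed

end

subsection \<open>Radial functions on three-space\<close>

lemma gradient_eqI:
  assumes "(f has_derivative (\<lambda>h. v \<bullet> h)) (at x)"
  shows "gradient f x = v"
  using frechet_derivative_at[OF assms, symmetric]
  by (simp add: gradient_def vec_eq_iff inner_axis)

lemma C1_onI:
  assumes "\<And>x. x \<in> S \<Longrightarrow> (f has_derivative (\<lambda>h. v x \<bullet> h)) (at x)" and "continuous_on S v"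
  shows "C1_on S f"
proof -
  have "continuous_on S (gradient f)"
    by (rule continuous_on_eq[OF assms(2)]) (simp add: gradient_eqI[OF assms(1)])
  then show ?thesis using assms(1) by (auto simp: C1_on_def differentiable_def)
qed

lemma filterlim_norm_at_0: "filterlim norm (at 0 within {0..}) (at (0 :: 'a :: real_normed_vector))"
  unfolding filterlim_at by (auto simp: eventually_at_filter intro!: tendsto_eq_intros)

text \<open>At the origin a nonzero one-sided slope would give a conical tip, hence the condition on
  \<open>d\<close>. The gradient formula remains correct there because it evaluates to
  \<open>0\<close>.\<close>

lemma has_derivative_radial:
  fixes x :: "real ^ 3"
  assumes F: "(F has_real_derivative d) (at (norm x) within {0..})" and d: "x = 0 \<Longrightarrow> d = 0"
  shows "((\<lambda>z. F (norm z)) has_derivative (\<lambda>h. ((d / norm x) *\<^sub>R x) \<bullet> h)) (at x)"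
proof (cases "x = 0")
  case True
  have "((\<lambda>r. (F r - F 0) / (r - 0)) \<longlongrightarrow> 0) (at 0 within {0..})"
    using F d True by (simp add: has_field_derivative_iff)
  from filterlim_compose[OF this filterlim_norm_at_0]
  have "((\<lambda>h :: real ^ 3. (F (norm h) - F 0) / norm h) \<longlongrightarrow> 0) (at 0)" by simp
  then have "((\<lambda>h :: real ^ 3. norm ((F (norm h) - F 0) / norm h)) \<longlongrightarrow> 0) (at 0)"
    by (rule tendsto_norm_zero)
  then show ?thesis using True by (simp add: has_derivative_at abs_divide)
next
  case False
  then have "(F has_real_derivative d) (at (norm x))"
    using F at_within_halfline[of "norm x"] by simp
  then have "(F has_derivative (\<lambda>h. d * h)) (at (norm x))"
    by (simp add: has_field_derivative_def)
  from has_derivative_compose[OF has_derivative_norm[OF False] this] show ?thesis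
    by (simp add: sgn_div_norm inner_commute divide_inverse_commute mult.commute mult.left_commute)
qed

text \<open>A bounded direction field such as \<open>x / norm x\<close> has no limit at the origin;
  a radial factor that vanishes there restores continuity.\<close>

lemma continuous_on_radial_direction:
  fixes S :: "(real ^ 3) set"
  assumes c: "continuous_on D c" and S: "\<And>x. x \<in> S \<Longrightarrow> norm x \<in> D" and c0: "c 0 = 0"
    and w: "continuous_on (S - {0}) w" and w_bound: "\<And>x. norm (w x) \<le> 1"
  shows "continuous_on S (\<lambda>x. c (norm x) *\<^sub>R (w x :: real ^ 3))"
proof (rule continuous_on_eq_continuous_within[THEN iffD2], rule ballI)
  fix x assume x: "x \<in> S"
  have cn: "continuous_on S (\<lambda>x. c (norm x))"
    by (rule continuous_on_compose2[OF c]) (auto intro!: continuous_intros S)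
  show "continuous (at x within S) (\<lambda>x. c (norm x) *\<^sub>R w x)"
  proof (cases "x = 0")
    case True
    have lim: "((\<lambda>z. c (norm z)) \<longlongrightarrow> 0) (at 0 within S)"
      using cn x True c0 by (auto simp: continuous_on_def)
    have "((\<lambda>z. c (norm z) *\<^sub>R w z) \<longlongrightarrow> 0) (at 0 within S)"
    proof (rule Lim_null_comparison)
      show "\<forall>\<^sub>F z in at 0 within S. norm (c (norm z) *\<^sub>R w z) \<le> \<bar>c (norm z)\<bar>"
        using w_bound by (auto intro!: always_eventually mult_left_le)
      show "((\<lambda>z. \<bar>c (norm z)\<bar>) \<longlongrightarrow> 0) (at 0 within S)"
        by (rule tendsto_rabs_zero[OF lim])
    qed
    then show ?thesis using True c0 by (simp add: continuous_within)
  next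
    case False
    have "continuous_on (S - {0}) (\<lambda>x. c (norm x) *\<^sub>R w x)"
      by (intro continuous_intros w continuous_on_subset[OF cn]) auto
    then have "continuous (at x within (S - {0})) (\<lambda>x. c (norm x) *\<^sub>R w x)"
      using x False by (simp add: continuous_on_eq_continuous_within)
    moreover have "at x within (S - {0}) = at x within S"
      using False by (intro at_within_nhd[of x "- {0}"]) auto
    ultimately show ?thesis by simp
  qed
qed

lemma
  fixes S :: "(real ^ 3) set"
  assumes F: "\<And>r. r \<in> D \<Longrightarrow> (F has_real_derivative F' r) (at r within {0..})"
    and F': "continuous_on D F'" "F' 0 = 0" and S: "\<And>x. x \<in> S \<Longrightarrow> norm x \<in> D"
  shows C1_on_radial: "C1_on S (\<lambda>x. F (norm x))"
    and gradient_radial: "x \<in> S \<Longrightarrow> gradient (\<lambda>x. F (norm x)) x = (F' (norm x) / norm x) *\<^sub>R x"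
proof -
  have deriv: "((\<lambda>z. F (norm z)) has_derivative (\<lambda>h. ((F' (norm x) / norm x) *\<^sub>R x) \<bullet> h)) (at x)"
    if "x \<in> S" for x
    by (rule has_derivative_radial) (use F[OF S[OF that]] F'(2) in auto)
  then show "x \<in> S \<Longrightarrow> gradient (\<lambda>x. F (norm x)) x = (F' (norm x) / norm x) *\<^sub>R x"
    by (rule gradient_eqI)
  have "continuous_on S (\<lambda>x. F' (norm x) *\<^sub>R (x /\<^sub>R norm x))"
  proof (rule continuous_on_radial_direction[OF F'(1) S F'(2)])
    show "norm (x /\<^sub>R norm x) \<le> 1" for x :: "real ^ 3" by (cases "x = 0") auto
  qed (auto intro!: continuous_intros)
  then have "continuous_on S (\<lambda>x. (F' (norm x) / norm x) *\<^sub>R x)"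
    by (simp add: divide_inverse)
  with deriv show "C1_on S (\<lambda>x. F (norm x))" by (rule C1_onI)
qed

text \<open>For a radial potential \<open>U\<close> and \<open>a = U' / r\<close>, the functions
  \<open>a (norm x) * x $ i\<close> are the components of its gradient. Only \<open>b = r a'\<close>
  has to extend continuously by \<open>0\<close> to the center; \<open>a\<close> may fail to be
  differentiable there, which the factor \<open>x $ i\<close> compensates.\<close>

lemma
  fixes a b :: "real \<Rightarrow> real" and i :: 3
  defines "v \<equiv> \<lambda>x :: real ^ 3. a (norm x) *\<^sub>R axis i 1 + (b (norm x) * x $ i / (norm x)\<^sup>2) *\<^sub>R x"
  assumes a: "continuous_on {0..} a" "\<And>r. 0 < r \<Longrightarrow> (a has_real_derivative b r / r) (at r)"
    and b: "continuous_on {0..} b" "b 0 = 0"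
  shows C1_on_radial_component: "C1_on UNIV (\<lambda>x. a (norm x) * x $ i)"
    and gradient_radial_component: "gradient (\<lambda>x. a (norm x) * x $ i) x = v x"
proof -
  have deriv: "((\<lambda>x. a (norm x) * x $ i) has_derivative (\<lambda>h. v x \<bullet> h)) (at x)" for x
  proof (cases "x = 0")
    case True
    have "(a \<longlongrightarrow> a 0) (at 0 within {0..})" using a(1) by (auto simp: continuous_on_def)
    from filterlim_compose[OF this filterlim_norm_at_0]
    have "((\<lambda>h :: real ^ 3. a (norm h) - a 0) \<longlongrightarrow> 0) (at 0)" by (rule LIM_zero)
    then have lim: "((\<lambda>h :: real ^ 3. \<bar>a (norm h) - a 0\<bar>) \<longlongrightarrow> 0) (at 0)" by (rule tendsto_rabs_zero)
    have "((\<lambda>h :: real ^ 3. norm (a (norm h) * h $ i - a 0 * h $ i) / norm h) \<longlongrightarrow> 0) (at 0)"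
    proof (rule Lim_null_comparison[OF always_eventually lim], rule allI)
      fix h :: "real ^ 3"
      have "norm (a (norm h) * h $ i - a 0 * h $ i) = \<bar>a (norm h) - a 0\<bar> * \<bar>h $ i\<bar>"
        by (simp add: abs_mult flip: left_diff_distrib)
      also have "\<dots> \<le> \<bar>a (norm h) - a 0\<bar> * norm h"
        by (intro mult_left_mono component_le_norm_cart) auto
      finally show "norm (norm (a (norm h) * h $ i - a 0 * h $ i) / norm h) \<le> \<bar>a (norm h) - a 0\<bar>"
        by (cases "h = 0") (auto simp: pos_divide_le_eq)
    qed
    then show ?thesis
      using True by (simp add: has_derivative_at v_def inner_axis' bounded_linear_mult_right
          bounded_linear_compose[OF bounded_linear_mult_right bounded_linear_vec_nth, unfolded o_def])
  next
    case False
    have an: "((\<lambda>z. a (norm z)) has_derivative (\<lambda>h. ((b (norm x) / norm x / norm x) *\<^sub>R x) \<bullet> h)) (at x)"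
      using False a(2)[of "norm x"] at_within_halfline[of "norm x"] by (intro has_derivative_radial) auto
    have ni: "((\<lambda>z. z $ i) has_derivative (\<lambda>h. h $ i)) (at x)"
      by (rule bounded_linear_imp_has_derivative[OF bounded_linear_vec_nth])
    show ?thesis
      by (rule has_derivative_eq_rhs[OF has_derivative_mult[OF an ni]])
        (auto simp: v_def inner_add_left inner_axis' power2_eq_square)
  qed
  show "gradient (\<lambda>x. a (norm x) * x $ i) x = v x" by (rule gradient_eqI[OF deriv])
  have "continuous_on UNIV (\<lambda>x :: real ^ 3. a (norm x))"
    by (rule continuous_on_compose2[OF a(1)]) (auto intro!: continuous_intros)
  moreover have "continuous_on UNIV (\<lambda>x :: real ^ 3. b (norm x) *\<^sub>R ((x $ i / (norm x)\<^sup>2) *\<^sub>R x))"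
  proof (rule continuous_on_radial_direction[OF b(1) _ b(2)])
    fix x :: "real ^ 3"
    have "norm x * \<bar>x $ i\<bar> \<le> norm x * norm x"
      by (intro mult_left_mono component_le_norm_cart) auto
    then show "norm ((x $ i / (norm x)\<^sup>2) *\<^sub>R x) \<le> 1"
      by (cases "x = 0") (auto simp: power2_eq_square divide_simps mult.commute)
  qed (auto intro!: continuous_intros)
  ultimately have "continuous_on UNIV v"
    unfolding v_def by (auto intro!: continuous_intros)
  with deriv show "C1_on UNIV (\<lambda>x. a (norm x) * x $ i)" by (rule C1_onI)
qed

text \<open>With \<open>U' = a r\<close> and \<open>b = r a'\<close>, the value
  \<open>3 a + b\<close> is \<open>U'' + 2 U' / r\<close>, written without a division at the
  center.\<close>

lemma
  fixes U a b :: "real \<Rightarrow> real"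
  assumes U: "\<And>r. 0 \<le> r \<Longrightarrow> (U has_real_derivative a r * r) (at r within {0..})"
    and a: "continuous_on {0..} a" "\<And>r. 0 < r \<Longrightarrow> (a has_real_derivative b r / r) (at r)"
    and b: "continuous_on {0..} b" "b 0 = 0"
  shows C2_on_radial: "C2_on UNIV (\<lambda>x. U (norm x))"
    and laplacian_radial: "laplacian (\<lambda>x. U (norm x)) x = 3 * a (norm x) + b (norm x)"
proof -
  have cont: "continuous_on {0..} (\<lambda>r. a r * r)" by (intro continuous_intros a(1))
  have "gradient (\<lambda>x. U (norm x)) x = a (norm x) *\<^sub>R x" for x
    using gradient_radial[of "{0..}" U "\<lambda>r. a r * r" UNIV x] U cont by (cases "x = 0") auto
  then have grad: "(\<lambda>x. gradient (\<lambda>x. U (norm x)) x $ i) = (\<lambda>x. a (norm x) * x $ i)" for i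
    by (simp add: fun_eq_iff)
  show "C2_on UNIV (\<lambda>x. U (norm x))"
    using C1_on_radial[of "{0..}" U "\<lambda>r. a r * r" UNIV] U cont C1_on_radial_component[OF a b]
    by (auto simp: C2_on_def grad)
  have "laplacian (\<lambda>x. U (norm x)) x =
      (\<Sum>i\<in>UNIV. a (norm x) + b (norm x) / (norm x)\<^sup>2 * (x $ i * x $ i))"
    unfolding laplacian_def grad
    by (intro sum.cong refl) (subst gradient_radial_component[OF a b], simp_all)
  also have "\<dots> = 3 * a (norm x) + b (norm x) / (norm x)\<^sup>2 * (x \<bullet> x)"
    by (simp add: sum.distrib sum_distrib_left inner_vec_def)
  also have "\<dots> = 3 * a (norm x) + b (norm x)"
    using b(2) by (cases "x = 0") (auto simp: power2_norm_eq_inner)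
  finally show "laplacian (\<lambda>x. U (norm x)) x = 3 * a (norm x) + b (norm x)" .
qed

lemma spherically_symmetric_radial: "spherically_symmetric (\<lambda>x. F (norm x))"
  by (auto simp: spherically_symmetric_def orthogonal_transformation_norm)

subsection \<open>The regularised structure equation\<close>

text \<open>\<open>k = 0\<close> is the Newtonian, \<open>k = 1\<close> the relativistic case; \<open>G\<close> and \<open>H\<close> are density and
  (relativistically active) pressure as functions of \<open>y\<close>. Neither needs to be Lipschitz
  continuous at the vacuum value \<open>y = 0\<close>.\<close>

locale structure_equation =
  fixes G H :: "real \<Rightarrow> real" and y0 k :: real
  assumes y0_pos: "0 < y0" and k_nonneg: "0 \<le> k" and k_le_1: "k \<le> 1"
    and G_cont: "continuous_on {..y0} G" and H_cont: "continuous_on {..y0} H"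
    and G_zero: "\<And>x. x \<le> 0 \<Longrightarrow> G x = 0" and H_zero: "\<And>x. x \<le> 0 \<Longrightarrow> H x = 0"
    and G_pos: "\<And>x. 0 < x \<Longrightarrow> x \<le> y0 \<Longrightarrow> 0 < G x"
    and G_mono: "\<And>x z. x \<le> z \<Longrightarrow> z \<le> y0 \<Longrightarrow> G x \<le> G z"
    and H_mono: "\<And>x z. x \<le> z \<Longrightarrow> z \<le> y0 \<Longrightarrow> H x \<le> H z"
    and G_lip: "\<And>e. 0 < e \<Longrightarrow> \<exists>L\<ge>0. \<forall>x\<in>{e..y0}. \<forall>z\<in>{e..y0}. \<bar>G x - G z\<bar> \<le> L * \<bar>x - z\<bar>"
    and H_lip: "\<And>e. 0 < e \<Longrightarrow> \<exists>L\<ge>0. \<forall>x\<in>{e..y0}. \<forall>z\<in>{e..y0}. \<bar>H x - H z\<bar> \<le> L * \<bar>x - z\<bar>"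
begin

lemma G_nonneg: "x \<le> y0 \<Longrightarrow> 0 \<le> G x"
  using G_zero[of x] G_pos[of x] by (cases "x \<le> 0") (auto intro: less_imp_le)

lemma H_nonneg: "x \<le> y0 \<Longrightarrow> 0 \<le> H x"
  using H_zero[of x] H_zero[of 0] H_mono[of 0 x] by (cases "x \<le> 0") auto

text \<open>The bound by \<open>y0\<close> keeps the values where \<open>G\<close> and
  \<open>H\<close> are controlled; the function \<open>g\<close> behind them is meaningful only
  below \<open>y_max\<close>.\<close>

definition admissible :: "(real \<Rightarrow> real) \<Rightarrow> bool" where
  "admissible \<sigma> \<longleftrightarrow> continuous_on {0..} \<sigma> \<and> (\<forall>r\<ge>0. \<sigma> r \<le> y0)"

definition ms :: "(real \<Rightarrow> real) \<Rightarrow> real \<Rightarrow> real" where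
  "ms \<sigma> r = 4 * pi * integral {0..r} (\<lambda>s. s\<^sup>2 * G (\<sigma> s))"

definition \<phi> :: "(real \<Rightarrow> real) \<Rightarrow> real \<Rightarrow> real" where
  "\<phi> \<sigma> r = 1 - 2 * k * ms \<sigma> r / r"

text \<open>While \<open>y\<close> is nonnegative, \<open>\<phi>_exp_bound\<close> yields the
  barrier \<open>exp (- 4 * y0) = 2 * \<delta>\<close>. Halving it leaves a gap between the bound
  and the cut-off, on which the continuity argument in \<open>\<phi>_lower_bound\<close>
  runs.\<close>

definition \<delta> :: real where "\<delta> = exp (- 4 * y0) / 2"

text \<open>Cutting the denominator off at \<open>\<delta>\<close> makes the right hand side globally defined; the a priori
  bound \<open>\<phi>_lower_bound\<close> below shows that the cut-off is never active.\<close>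

definition \<Psi> :: "(real \<Rightarrow> real) \<Rightarrow> real \<Rightarrow> real" where
  "\<Psi> \<sigma> r = - ((ms \<sigma> r / r\<^sup>2 + 4 * pi * r * H (\<sigma> r)) / max \<delta> (\<phi> \<sigma> r))"

lemma \<delta>_pos: "0 < \<delta>"
  by (simp add: \<delta>_def)

lemma continuous_on_G_admissible: "admissible \<sigma> \<Longrightarrow> continuous_on {0..} (\<lambda>r. G (\<sigma> r))"
  unfolding admissible_def by (auto intro!: continuous_on_compose2[OF G_cont])

lemma continuous_on_H_admissible: "admissible \<sigma> \<Longrightarrow> continuous_on {0..} (\<lambda>r. H (\<sigma> r))"
  unfolding admissible_def by (auto intro!: continuous_on_compose2[OF H_cont])

lemma continuous_on_ms_integrand:
  "admissible \<sigma> \<Longrightarrow> continuous_on {0..} (\<lambda>s. s\<^sup>2 * G (\<sigma> s))"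
  by (intro continuous_intros continuous_on_G_admissible)

lemma continuous_on_ms: "admissible \<sigma> \<Longrightarrow> continuous_on {0..} (ms \<sigma>)"
  unfolding ms_def
  by (intro continuous_intros continuous_on_integral_halfline continuous_on_ms_integrand)

lemma DERIV_ms:
  assumes "admissible \<sigma>" "0 \<le> r"
  shows "(ms \<sigma> has_real_derivative 4 * pi * r\<^sup>2 * G (\<sigma> r)) (at r within {0..})"
proof -
  have "((\<lambda>u. 4 * pi * integral {0..u} (\<lambda>s. s\<^sup>2 * G (\<sigma> s))) has_real_derivative
      4 * pi * (r\<^sup>2 * G (\<sigma> r))) (at r within {0..})"
    using DERIV_integral_halfline[OF continuous_on_ms_integrand[OF assms(1)] assms(2)]
    by (rule DERIV_cmult)
  then show ?thesis by (simp add: ms_def[abs_def] mult.assoc)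
qed

lemma ms_0: "ms \<sigma> 0 = 0"
  by (simp add: ms_def)

lemma has_integral_cube: "0 \<le> r \<Longrightarrow> ((\<lambda>s. s\<^sup>2 * c) has_integral r ^ 3 / 3 * c) {0..r}" for r c :: real
proof -
  assume "0 \<le> r"
  have "((\<lambda>s. s\<^sup>2 * c) has_integral r ^ 3 / 3 * c - 0 ^ 3 / 3 * c) {0..r}"
    by (rule integral_DERIV_halfline[OF _ \<open>0 \<le> r\<close>]) (auto intro!: derivative_eq_intros)
  then show ?thesis by simp
qed

lemma ms_le:
  assumes "admissible \<sigma>" "0 \<le> r"
  shows "ms \<sigma> r \<le> 4 * pi / 3 * G y0 * r ^ 3"
proof -
  have "integral {0..r} (\<lambda>s. s\<^sup>2 * G (\<sigma> s)) \<le> integral {0..r} (\<lambda>s. s\<^sup>2 * G y0)"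
    using assms has_integral_cube[of r "G y0"]
    by (intro integral_le integrable_halfline[OF continuous_on_ms_integrand])
      (auto intro!: mult_left_mono G_mono simp: admissible_def)
  then have "integral {0..r} (\<lambda>s. s\<^sup>2 * G (\<sigma> s)) \<le> r ^ 3 / 3 * G y0"
    by (simp only: integral_unique[OF has_integral_cube[OF assms(2)]])
  then have "4 * pi * integral {0..r} (\<lambda>s. s\<^sup>2 * G (\<sigma> s)) \<le> 4 * pi * (r ^ 3 / 3 * G y0)"
    by (intro mult_left_mono) auto
  moreover have "4 * pi * (r ^ 3 / 3 * G y0) = 4 * pi / 3 * G y0 * r ^ 3" by simp
  ultimately show ?thesis by (simp only: ms_def)
qed

lemma ms_ge:
  assumes "admissible \<sigma>" "0 \<le> r" and c: "\<And>s. 0 \<le> s \<Longrightarrow> s \<le> r \<Longrightarrow> c \<le> G (\<sigma> s)"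
  shows "4 * pi / 3 * c * r ^ 3 \<le> ms \<sigma> r"
proof -
  have "integral {0..r} (\<lambda>s. s\<^sup>2 * c) \<le> integral {0..r} (\<lambda>s. s\<^sup>2 * G (\<sigma> s))"
    using assms has_integral_cube[of r c]
    by (intro integral_le integrable_halfline[OF continuous_on_ms_integrand])
      (auto intro!: mult_left_mono)
  then have "r ^ 3 / 3 * c \<le> integral {0..r} (\<lambda>s. s\<^sup>2 * G (\<sigma> s))"
    by (simp only: integral_unique[OF has_integral_cube[OF assms(2)]])
  then have "4 * pi * (r ^ 3 / 3 * c) \<le> 4 * pi * integral {0..r} (\<lambda>s. s\<^sup>2 * G (\<sigma> s))"
    by (intro mult_left_mono) auto
  moreover have "4 * pi * (r ^ 3 / 3 * c) = 4 * pi / 3 * c * r ^ 3" by simp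
  ultimately show ?thesis by (simp only: ms_def)
qed

lemma ms_mono:
  assumes "admissible \<sigma>" "0 \<le> r" "r \<le> s"
  shows "ms \<sigma> r \<le> ms \<sigma> s"
proof (rule DERIV_nonneg_imp_increasing_open[OF \<open>r \<le> s\<close>])
  fix x assume "r < x"
  then have "0 \<le> G (\<sigma> x)" "0 < x"
    using assms by (auto simp: admissible_def intro!: G_nonneg)
  then show "\<exists>y. (ms \<sigma> has_real_derivative y) (at x) \<and> 0 \<le> y"
    using DERIV_ms[OF assms(1), of x] at_within_halfline[of x] by auto
qed (use assms in \<open>auto intro: continuous_on_subset[OF continuous_on_ms]\<close>)

lemma ms_nonneg: "admissible \<sigma> \<Longrightarrow> 0 \<le> r \<Longrightarrow> 0 \<le> ms \<sigma> r"
  using ms_mono[of \<sigma> 0 r] ms_0 by simp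

lemma ms_cong:
  "(\<And>s. 0 \<le> s \<Longrightarrow> s \<le> r \<Longrightarrow> \<sigma> s = \<tau> s) \<Longrightarrow> ms \<sigma> r = ms \<tau> r"
  unfolding ms_def by (auto intro!: integral_cong)

lemma \<Psi>_cong:
  "(\<And>s. 0 \<le> s \<Longrightarrow> s \<le> r \<Longrightarrow> \<sigma> s = \<tau> s) \<Longrightarrow> 0 \<le> r \<Longrightarrow> \<Psi> \<sigma> r = \<Psi> \<tau> r"
  using ms_cong[of r \<sigma> \<tau>] by (simp add: \<Psi>_def \<phi>_def)

lemma \<Psi>_0: "\<Psi> \<sigma> 0 = 0"
  by (simp add: \<Psi>_def)

definition B :: real where "B = 4 * pi / 3 * G y0 + 4 * pi * H y0"

lemma B_nonneg: "0 \<le> B"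
  using G_nonneg[of y0] H_nonneg[of y0] by (simp add: B_def)

lemma numerator_nonneg:
  assumes "admissible \<sigma>" "0 \<le> r"
  shows "0 \<le> ms \<sigma> r / r\<^sup>2 + 4 * pi * r * H (\<sigma> r)"
  using assms ms_nonneg[OF assms] H_nonneg[of "\<sigma> r"] by (auto simp: admissible_def)

lemma numerator_le:
  assumes "admissible \<sigma>" "0 \<le> r"
  shows "ms \<sigma> r / r\<^sup>2 + 4 * pi * r * H (\<sigma> r) \<le> B * r"
proof (cases "r = 0")
  case False
  then have "0 < r" using assms by simp
  have "ms \<sigma> r / r\<^sup>2 \<le> 4 * pi / 3 * G y0 * r"
    using ms_le[OF assms] \<open>0 < r\<close>
    by (simp add: pos_divide_le_eq power2_eq_square power3_eq_cube mult.assoc)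
  moreover have "4 * pi * r * H (\<sigma> r) \<le> 4 * pi * r * H y0"
    using assms by (intro mult_left_mono H_mono) (auto simp: admissible_def)
  moreover have "B * r = 4 * pi / 3 * G y0 * r + 4 * pi * r * H y0"
    by (simp add: B_def algebra_simps)
  ultimately show ?thesis by linarith
qed simp

lemma \<Psi>_nonpos: "admissible \<sigma> \<Longrightarrow> 0 \<le> r \<Longrightarrow> \<Psi> \<sigma> r \<le> 0"
  using numerator_nonneg \<delta>_pos by (simp add: \<Psi>_def max_def divide_nonneg_pos)

lemma \<Psi>_bound:
  assumes "admissible \<sigma>" "0 \<le> r"
  shows "\<bar>\<Psi> \<sigma> r\<bar> \<le> B / \<delta> * r"
proof -
  have "\<bar>\<Psi> \<sigma> r\<bar> = (ms \<sigma> r / r\<^sup>2 + 4 * pi * r * H (\<sigma> r)) / max \<delta> (\<phi> \<sigma> r)"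
    using numerator_nonneg[OF assms] \<delta>_pos by (simp add: \<Psi>_def abs_divide)
  also have "\<dots> \<le> (B * r) / \<delta>"
    using numerator_le[OF assms] numerator_nonneg[OF assms] \<delta>_pos by (intro frac_le) auto
  finally show ?thesis by simp
qed

lemma continuous_on_\<phi>: "admissible \<sigma> \<Longrightarrow> continuous_on {0<..} (\<phi> \<sigma>)"
  unfolding \<phi>_def
  by (intro continuous_intros continuous_on_subset[OF continuous_on_ms]) auto

lemma continuous_on_\<Psi>:
  assumes "admissible \<sigma>"
  shows "continuous_on {0..} (\<Psi> \<sigma>)"
proof (rule continuous_on_halfline_vanishing[where C = "B / \<delta>"])
  have "continuous_on {0<..} (ms \<sigma>)" "continuous_on {0<..} (\<lambda>r. H (\<sigma> r))"
    using continuous_on_ms[OF assms] continuous_on_H_admissible[OF assms]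
    by (auto elim!: continuous_on_subset)
  then show "continuous_on {0<..} (\<Psi> \<sigma>)"
    unfolding \<Psi>_def using \<delta>_pos
    by (intro continuous_intros continuous_on_\<phi> assms) (auto simp: max_def)
qed (rule \<Psi>_bound[OF assms])

text \<open>Above the level \<open>e\<close> both \<open>G\<close> and \<open>H\<close> are
  Lipschitz, and \<open>\<delta>\<close> bounds both denominators from below. The weight
  \<open>r\<close> comes from the variation of the numerator, where a mass of order
  \<open>r ^ 3\<close> is divided by \<open>r\<^sup>2\<close>. The weight \<open>r ^ 3\<close> comes
  from the denominator: its variation is of order \<open>r\<^sup>2\<close>, and it is multiplied by
  a numerator of order \<open>r\<close>.\<close>

lemma \<Psi>_lip:
  assumes "0 < e"
  shows "\<exists>L\<ge>0. \<forall>\<sigma> \<tau> r D. admissible \<sigma> \<longrightarrow> admissible \<tau> \<longrightarrow> 0 \<le> r \<longrightarrow>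
    (\<forall>s\<ge>0. e \<le> \<sigma> s \<and> e \<le> \<tau> s) \<longrightarrow> (\<forall>s\<in>{0..r}. \<bar>\<sigma> s - \<tau> s\<bar> \<le> D) \<longrightarrow>
    \<bar>\<Psi> \<sigma> r - \<Psi> \<tau> r\<bar> \<le> L * (r + r ^ 3) * D"
proof -
  obtain LG where LG: "LG \<ge> 0" "\<And>x z. x \<in> {e..y0} \<Longrightarrow> z \<in> {e..y0} \<Longrightarrow> \<bar>G x - G z\<bar> \<le> LG * \<bar>x - z\<bar>"
    using G_lip[OF assms] by blast
  obtain LH where LH: "LH \<ge> 0" "\<And>x z. x \<in> {e..y0} \<Longrightarrow> z \<in> {e..y0} \<Longrightarrow> \<bar>H x - H z\<bar> \<le> LH * \<bar>x - z\<bar>"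
    using H_lip[OF assms] by blast
  define A where "A = 4 * pi / 3 * LG + 4 * pi * LH"
  define C where "C = 8 * pi / 3 * LG"
  define L where "L = A / \<delta> + B * C / \<delta>\<^sup>2"
  have nn: "0 \<le> A" "0 \<le> C" using LG(1) LH(1) by (auto simp: A_def C_def)
  have "0 \<le> L" using nn B_nonneg \<delta>_pos by (simp add: L_def)
  moreover have "\<bar>\<Psi> \<sigma> r - \<Psi> \<tau> r\<bar> \<le> L * (r + r ^ 3) * D"
    if ad: "admissible \<sigma>" "admissible \<tau>" and r: "0 \<le> r"
      and ge: "\<forall>s\<ge>0. e \<le> \<sigma> s \<and> e \<le> \<tau> s" and D: "\<forall>s\<in>{0..r}. \<bar>\<sigma> s - \<tau> s\<bar> \<le> D" for \<sigma> \<tau> r D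
  proof (cases "r = 0")
    case True
    then show ?thesis by (simp add: \<Psi>_0)
  next
    case False
    then have r: "0 < r" using r by simp
    have "0 \<le> D" using bspec[OF D, of r] r by auto
    have mem: "\<sigma> s \<in> {e..y0}" "\<tau> s \<in> {e..y0}" if "0 \<le> s" for s
      using that ge ad by (auto simp: admissible_def)
    have dG: "\<bar>G (\<sigma> s) - G (\<tau> s)\<bar> \<le> LG * D" and dH: "\<bar>H (\<sigma> s) - H (\<tau> s)\<bar> \<le> LH * D" if "s \<in> {0..r}" for s
      using LG(2)[of "\<sigma> s" "\<tau> s"] LH(2)[of "\<sigma> s" "\<tau> s"] mem[of s] that bspec[OF D that]
        mult_left_mono[OF bspec[OF D that] LG(1)] mult_left_mono[OF bspec[OF D that] LH(1)] by auto
    have "\<bar>integral {0..r} (\<lambda>s. s\<^sup>2 * G (\<sigma> s)) - integral {0..r} (\<lambda>s. s\<^sup>2 * G (\<tau> s))\<bar>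
        = norm (integral {0..r} (\<lambda>s. s\<^sup>2 * G (\<sigma> s) - s\<^sup>2 * G (\<tau> s)))"
      by (simp add: integral_diff integrable_halfline continuous_on_ms_integrand ad)
    also have "\<dots> \<le> integral {0..r} (\<lambda>s. s\<^sup>2 * (LG * D))"
    proof (rule integral_norm_bound_integral)
      fix s assume s: "s \<in> {0..r}"
      have "norm (s\<^sup>2 * G (\<sigma> s) - s\<^sup>2 * G (\<tau> s)) = s\<^sup>2 * \<bar>G (\<sigma> s) - G (\<tau> s)\<bar>"
        by (simp add: abs_mult flip: right_diff_distrib)
      also have "\<dots> \<le> s\<^sup>2 * (LG * D)" using dG[OF s] by (intro mult_left_mono) auto
      finally show "norm (s\<^sup>2 * G (\<sigma> s) - s\<^sup>2 * G (\<tau> s)) \<le> s\<^sup>2 * (LG * D)" .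
    next
      show "(\<lambda>s. s\<^sup>2 * (LG * D)) integrable_on {0..r}"
        using has_integral_integrable[OF has_integral_cube[of r "LG * D"]] r by simp
    qed (intro integrable_diff integrable_halfline continuous_on_ms_integrand ad)
    also have "\<dots> = r ^ 3 / 3 * (LG * D)"
      by (rule integral_unique) (use has_integral_cube[of r "LG * D"] r in simp)
    finally have int_diff: "\<bar>integral {0..r} (\<lambda>s. s\<^sup>2 * G (\<sigma> s)) - integral {0..r} (\<lambda>s. s\<^sup>2 * G (\<tau> s))\<bar>
        \<le> r ^ 3 / 3 * (LG * D)" .
    have "\<bar>ms \<sigma> r - ms \<tau> r\<bar> = 4 * pi * \<bar>integral {0..r} (\<lambda>s. s\<^sup>2 * G (\<sigma> s)) - integral {0..r} (\<lambda>s. s\<^sup>2 * G (\<tau> s))\<bar>"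
      by (simp add: ms_def abs_mult flip: right_diff_distrib)
    also have "\<dots> \<le> 4 * pi * (r ^ 3 / 3 * (LG * D))"
      using int_diff by (intro mult_left_mono) auto
    finally have dm: "\<bar>ms \<sigma> r - ms \<tau> r\<bar> \<le> 4 * pi / 3 * LG * D * r ^ 3" by (simp add: mult_ac)
    define N where "N \<rho> = ms \<rho> r / r\<^sup>2 + 4 * pi * r * H (\<rho> r)" for \<rho>
    define d where "d \<rho> = max \<delta> (\<phi> \<rho> r)" for \<rho>
    have d: "\<delta> \<le> d \<sigma>" "\<delta> \<le> d \<tau>" "0 < d \<sigma>" "0 < d \<tau>"
      using \<delta>_pos by (auto simp: d_def)
    have "\<bar>ms \<sigma> r / r\<^sup>2 - ms \<tau> r / r\<^sup>2\<bar> \<le> 4 * pi / 3 * LG * D * r"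
    proof -
      have "\<bar>ms \<sigma> r / r\<^sup>2 - ms \<tau> r / r\<^sup>2\<bar> = \<bar>ms \<sigma> r - ms \<tau> r\<bar> / r\<^sup>2"
        by (simp add: abs_divide flip: diff_divide_distrib)
      also have "\<dots> \<le> 4 * pi / 3 * LG * D * r ^ 3 / r\<^sup>2"
        using dm by (intro divide_right_mono) auto
      finally show ?thesis using r by (simp add: power2_eq_square power3_eq_cube)
    qed
    moreover have "\<bar>4 * pi * r * H (\<sigma> r) - 4 * pi * r * H (\<tau> r)\<bar> \<le> 4 * pi * r * (LH * D)"
    proof -
      have "\<bar>4 * pi * r * H (\<sigma> r) - 4 * pi * r * H (\<tau> r)\<bar> = 4 * pi * r * \<bar>H (\<sigma> r) - H (\<tau> r)\<bar>"
        using r by (simp add: abs_mult flip: right_diff_distrib)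
      then show ?thesis using dH[of r] r by (auto intro!: mult_left_mono)
    qed
    moreover have "A * r * D = 4 * pi / 3 * LG * D * r + 4 * pi * r * (LH * D)"
      by (simp add: A_def algebra_simps)
    ultimately have dN: "\<bar>N \<sigma> - N \<tau>\<bar> \<le> A * r * D"
      unfolding N_def by linarith
    have "\<bar>d \<sigma> - d \<tau>\<bar> \<le> \<bar>\<phi> \<sigma> r - \<phi> \<tau> r\<bar>"
      by (simp add: d_def)
    also have "\<phi> \<sigma> r - \<phi> \<tau> r = 2 * k / r * (ms \<tau> r - ms \<sigma> r)"
      by (simp add: \<phi>_def diff_divide_distrib right_diff_distrib)
    also have "\<bar>\<dots>\<bar> = k * (2 / r * \<bar>ms \<sigma> r - ms \<tau> r\<bar>)"
      using k_nonneg r by (simp add: abs_mult abs_minus_commute)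
    also have "\<dots> \<le> 1 * (2 / r * (4 * pi / 3 * LG * D * r ^ 3))"
      using k_nonneg k_le_1 dm r by (intro mult_mono mult_left_mono) auto
    also have "\<dots> = C * r\<^sup>2 * D"
      using r by (simp add: C_def power2_eq_square power3_eq_cube)
    finally have dd: "\<bar>d \<sigma> - d \<tau>\<bar> \<le> C * r\<^sup>2 * D" .
    have N\<tau>: "0 \<le> N \<tau>" "N \<tau> \<le> B * r"
      using numerator_nonneg[OF ad(2)] numerator_le[OF ad(2)] r by (auto simp: N_def)
    have "\<Psi> \<sigma> r - \<Psi> \<tau> r = N \<tau> / d \<tau> - N \<sigma> / d \<sigma>"
      by (simp add: \<Psi>_def N_def d_def)
    also have "\<dots> = (N \<tau> - N \<sigma>) / d \<sigma> + N \<tau> * (d \<sigma> - d \<tau>) / (d \<sigma> * d \<tau>)"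
      using d by (simp add: field_simps)
    finally have "\<bar>\<Psi> \<sigma> r - \<Psi> \<tau> r\<bar> \<le> \<bar>(N \<tau> - N \<sigma>) / d \<sigma>\<bar> + \<bar>N \<tau> * (d \<sigma> - d \<tau>) / (d \<sigma> * d \<tau>)\<bar>"
      by (simp only: abs_triangle_ineq)
    also have "\<bar>(N \<tau> - N \<sigma>) / d \<sigma>\<bar> \<le> (A * r * D) / \<delta>"
      unfolding abs_divide using dN d \<delta>_pos
      by (intro frac_le) (auto simp: abs_minus_commute)
    also have "\<bar>N \<tau> * (d \<sigma> - d \<tau>) / (d \<sigma> * d \<tau>)\<bar> \<le> (B * r) * (C * r\<^sup>2 * D) / (\<delta> * \<delta>)"
      unfolding abs_divide abs_mult using dd d N\<tau> \<delta>_pos B_nonneg r nn \<open>0 \<le> D\<close>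
      by (intro frac_le mult_mono) auto
    also have "A * r * D / \<delta> + B * r * (C * r\<^sup>2 * D) / (\<delta> * \<delta>) = A / \<delta> * (r * D) + B * C / \<delta>\<^sup>2 * (r ^ 3 * D)"
      by (simp add: power2_eq_square power3_eq_cube mult_ac)
    also have "\<dots> \<le> A / \<delta> * ((r + r ^ 3) * D) + B * C / \<delta>\<^sup>2 * ((r + r ^ 3) * D)"
      using nn B_nonneg \<delta>_pos r \<open>0 \<le> D\<close>
      by (intro add_mono mult_left_mono mult_right_mono) auto
    also have "\<dots> = L * (r + r ^ 3) * D" by (simp add: L_def algebra_simps)
    finally show ?thesis by simp
  qed
  ultimately show ?thesis by blast
qed

text \<open>The Lipschitz constants may blow up as the cut-off level tends to \<open>0\<close>, so
  the passage to the limit rests on continuity of \<open>G\<close> and dominated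
  convergence.\<close>

lemma ms_tendsto:
  assumes ad: "\<And>j. admissible (\<sigma> j)" "admissible \<tau>" and r: "0 \<le> r"
    and lim: "\<And>s. 0 \<le> s \<Longrightarrow> (\<lambda>j. \<sigma> j s) \<longlonglongrightarrow> \<tau> s"
  shows "(\<lambda>j. ms (\<sigma> j) r) \<longlonglongrightarrow> ms \<tau> r"
  unfolding ms_def
proof (rule tendsto_mult[OF tendsto_const], rule dominated_convergence(2)[where h = "\<lambda>s. s\<^sup>2 * G y0"])
  show "(\<lambda>s. s\<^sup>2 * G y0) integrable_on {0..r}"
    using has_integral_cube[OF r] by blast
next
  fix j s assume "s \<in> {0..r}"
  then show "norm (s\<^sup>2 * G (\<sigma> j s)) \<le> s\<^sup>2 * G y0"
    using ad(1)[of j] by (auto simp: abs_mult admissible_def G_nonneg intro!: mult_left_mono G_mono)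
next
  fix s assume s: "s \<in> {0..r}"
  have "(\<lambda>j. G (\<sigma> j s)) \<longlonglongrightarrow> G (\<tau> s)"
    by (rule continuous_on_tendsto_compose[OF G_cont lim]) (use s ad in \<open>auto simp: admissible_def\<close>)
  then show "(\<lambda>j. s\<^sup>2 * G (\<sigma> j s)) \<longlonglongrightarrow> s\<^sup>2 * G (\<tau> s)" by (intro tendsto_intros)
qed (use ad in \<open>auto intro!: integrable_halfline continuous_on_ms_integrand\<close>)

lemma \<Psi>_tendsto:
  assumes ad: "\<And>j. admissible (\<sigma> j)" "admissible \<tau>" and r: "0 \<le> r"
    and lim: "\<And>s. 0 \<le> s \<Longrightarrow> (\<lambda>j. \<sigma> j s) \<longlonglongrightarrow> \<tau> s"
  shows "(\<lambda>j. \<Psi> (\<sigma> j) r) \<longlonglongrightarrow> \<Psi> \<tau> r"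
proof (cases "r = 0")
  case False
  have "(\<lambda>j. H (\<sigma> j r)) \<longlonglongrightarrow> H (\<tau> r)"
    by (rule continuous_on_tendsto_compose[OF H_cont lim]) (use r ad in \<open>auto simp: admissible_def\<close>)
  then show ?thesis
    unfolding \<Psi>_def \<phi>_def using False \<delta>_pos ms_tendsto[OF ad r lim]
    by (intro tendsto_minus tendsto_divide tendsto_add tendsto_mult tendsto_max tendsto_diff tendsto_const)
      (auto simp: max_def)
qed (simp add: \<Psi>_0)

subsection \<open>Comparison of cut-off levels\<close>

text \<open>The lower level keeps the density away from the vacuum, and \<open>min x y0\<close>
  makes the operator meaningful for any continuous function that the iteration may produce. For
  \<open>e = 0\<close> the lower cut-off only replaces negative values by \<open>0\<close>, where
  \<open>G\<close> and \<open>H\<close> vanish anyway.\<close>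

definition cutoff :: "real \<Rightarrow> real \<Rightarrow> real" where
  "cutoff e x = max e (min x y0)"

definition sol :: "real \<Rightarrow> (real \<Rightarrow> real) \<Rightarrow> bool" where
  "sol e y \<longleftrightarrow> continuous_on {0..} y \<and>
     (\<forall>r\<ge>0. y r = y0 + integral {0..r} (\<Psi> (\<lambda>s. cutoff e (y s))))"

lemma admissible_cutoff:
  "continuous_on {0..} y \<Longrightarrow> e \<le> y0 \<Longrightarrow> admissible (\<lambda>s. cutoff e (y s))"
  unfolding admissible_def cutoff_def by (auto intro!: continuous_intros)

lemma cutoff_lipschitz: "\<bar>cutoff e x - cutoff e z\<bar> \<le> \<bar>x - z\<bar>"
  by (auto simp: cutoff_def max_def min_def)

lemma volterra_cutoff:
  assumes "0 < e" "e \<le> y0"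
  shows "\<exists>w W. volterra (\<lambda>y. \<Psi> (\<lambda>s. cutoff e (y s))) w W"
proof -
  obtain L where L: "L \<ge> 0"
    and lip: "\<And>\<sigma> \<tau> r D. admissible \<sigma> \<Longrightarrow> admissible \<tau> \<Longrightarrow> 0 \<le> r \<Longrightarrow>
    (\<forall>s\<ge>0. e \<le> \<sigma> s \<and> e \<le> \<tau> s) \<Longrightarrow> (\<forall>s\<in>{0..r}. \<bar>\<sigma> s - \<tau> s\<bar> \<le> D) \<Longrightarrow>
    \<bar>\<Psi> \<sigma> r - \<Psi> \<tau> r\<bar> \<le> L * (r + r ^ 3) * D"
    using \<Psi>_lip[OF assms(1)] by metis
  \<comment> \<open>One weight has to dominate both the size bound \<open>B / \<delta> * r\<close>
    and the Lipschitz bound, hence the sum.\<close>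
  define K where "K = L + B / \<delta>"
  have K: "0 \<le> B / \<delta>" "0 \<le> K"
    using L B_nonneg \<delta>_pos by (auto simp: K_def)
  have "volterra (\<lambda>y. \<Psi> (\<lambda>s. cutoff e (y s))) (\<lambda>r. K * (r + r ^ 3)) (\<lambda>r. K * (r\<^sup>2 / 2 + r ^ 4 / 4))"
  proof
    fix y :: "real \<Rightarrow> real" assume y: "continuous_on {0..} y"
    show "continuous_on {0..} (\<Psi> (\<lambda>s. cutoff e (y s)))"
      by (rule continuous_on_\<Psi>[OF admissible_cutoff[OF y assms(2)]])
    fix r :: real assume r: "0 \<le> r"
    have "\<bar>\<Psi> (\<lambda>s. cutoff e (y s)) r\<bar> \<le> B / \<delta> * r"
      by (rule \<Psi>_bound[OF admissible_cutoff[OF y assms(2)] r])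
    also have "\<dots> \<le> K * (r + r ^ 3)"
      using K L r by (intro mult_mono) (auto simp: K_def)
    finally show "\<bar>\<Psi> (\<lambda>s. cutoff e (y s)) r\<bar> \<le> K * (r + r ^ 3)" .
    fix z :: "real \<Rightarrow> real" and D assume z: "continuous_on {0..} z"
      and D: "\<And>s. 0 \<le> s \<Longrightarrow> s \<le> r \<Longrightarrow> \<bar>y s - z s\<bar> \<le> D"
    have "0 \<le> D" using D[of 0] r by auto
    have "\<bar>\<Psi> (\<lambda>s. cutoff e (y s)) r - \<Psi> (\<lambda>s. cutoff e (z s)) r\<bar> \<le> L * (r + r ^ 3) * D"
    proof (rule lip[OF admissible_cutoff[OF y assms(2)] admissible_cutoff[OF z assms(2)] r])
      show "\<forall>s\<in>{0..r}. \<bar>cutoff e (y s) - cutoff e (z s)\<bar> \<le> D"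
        using D cutoff_lipschitz by (meson atLeastAtMost_iff order_trans)
    qed (simp add: cutoff_def)
    also have "\<dots> \<le> K * (r + r ^ 3) * D"
      using K r \<open>0 \<le> D\<close> by (intro mult_right_mono) (auto simp: K_def)
    finally show "\<bar>\<Psi> (\<lambda>s. cutoff e (y s)) r - \<Psi> (\<lambda>s. cutoff e (z s)) r\<bar> \<le> K * (r + r ^ 3) * D" .
  next
    fix r :: real assume r: "0 \<le> r"
    show "((\<lambda>r. K * (r\<^sup>2 / 2 + r ^ 4 / 4)) has_real_derivative K * (r + r ^ 3)) (at r within {0..})"
      by (auto intro!: derivative_eq_intros)
    show "0 \<le> K * (r + r ^ 3)" using K r by simp
  qed auto
  then show ?thesis by blast
qed

lemma sol_exists_pos: "0 < e \<Longrightarrow> e \<le> y0 \<Longrightarrow> \<exists>y. sol e y"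
  using volterra_cutoff[of e] volterra.solution_exists[of _ _ _ y0] unfolding sol_def by metis

lemma sol_0: "sol e y \<Longrightarrow> y 0 = y0"
  by (simp add: sol_def)

lemma DERIV_sol:
  assumes "sol e y" "e \<le> y0" "0 \<le> r"
  shows "(y has_real_derivative \<Psi> (\<lambda>s. cutoff e (y s)) r) (at r within {0..})"
proof (rule has_field_derivative_transform_within[where d = 1])
  show "((\<lambda>r. y0 + integral {0..r} (\<Psi> (\<lambda>s. cutoff e (y s)))) has_real_derivative
      \<Psi> (\<lambda>s. cutoff e (y s)) r) (at r within {0..})"
    using DERIV_add[OF DERIV_const DERIV_integral_halfline[OF continuous_on_\<Psi>[OF admissible_cutoff]]] assms
    by (auto simp: sol_def)
qed (use assms in \<open>auto simp: sol_def\<close>)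

lemma sol_decreasing:
  assumes "sol e y" "e \<le> y0" "0 \<le> r" "r \<le> s"
  shows "y s \<le> y r"
proof (rule nonincreasing_Icc[where f = y and a = r and b = s])
  have ad: "admissible (\<lambda>s. cutoff e (y s))"
    using assms by (auto simp: sol_def intro: admissible_cutoff)
  fix x assume "r < x" "x < s"
  then show "\<exists>d. (y has_real_derivative d) (at x) \<and> d \<le> 0"
    using DERIV_sol[OF assms(1,2), of x] assms(3) \<Psi>_nonpos[OF ad, of x] at_within_halfline[of x] by auto
qed (use assms in \<open>auto simp: sol_def intro: continuous_on_subset\<close>)

lemma sol_le: "sol e y \<Longrightarrow> e \<le> y0 \<Longrightarrow> 0 \<le> r \<Longrightarrow> y r \<le> y0"
  using sol_decreasing[of e y 0 r] sol_0[of e y] by simp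

text \<open>Solutions agree until they drop to the larger cut-off, where the equation is Lipschitz, and
  afterwards both truncations lie below it. So neither uniqueness nor the limit \<open>e \<rightarrow> 0\<close>
  needs Lipschitz continuity of \<open>G\<close> at the vacuum value.\<close>

lemma cutoff_comparison:
  assumes z1: "sol e1 z1" and z2: "sol e2 z2" and e: "0 \<le> e1" "e1 \<le> e2" "0 < e2" "e2 \<le> y0" and t: "0 \<le> t"
  shows "\<bar>cutoff e1 (z1 t) - cutoff e2 (z2 t)\<bar> \<le> e2"
proof -
  have e1: "e1 \<le> y0" using e by simp
  obtain w W where V: "volterra (\<lambda>y. \<Psi> (\<lambda>s. cutoff e2 (y s))) w W"
    using volterra_cutoff e by blast
  \<comment> \<open>Up to such a radius monotonicity keeps \<open>z1\<close> at or above
    \<open>e2\<close>, so truncating it at \<open>e1\<close> or at \<open>e2\<close> has the same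
    effect and both functions solve the equation for \<open>e2\<close>.\<close>
  have agree: "z1 b = z2 b" if b: "0 \<le> b" "e2 \<le> z1 b" "e2 \<le> z2 b" for b
  proof (rule volterra.unique_on_interval[OF V, where y = z1 and z = z2 and r = b and b = b and a = y0])
    show "continuous_on {0..} z1" "continuous_on {0..} z2" using z1 z2 by (auto simp: sol_def)
    fix r assume r: "0 \<le> r" "r \<le> b"
    have "cutoff e1 (z1 s) = cutoff e2 (z1 s)" if "0 \<le> s" "s \<le> b" for s
      using sol_decreasing[OF z1 e1 that] b e sol_le[OF z1 e1, of s] that by (auto simp: cutoff_def)
    then have "integral {0..r} (\<Psi> (\<lambda>s. cutoff e1 (z1 s))) = integral {0..r} (\<Psi> (\<lambda>s. cutoff e2 (z1 s)))"
      using r by (intro integral_cong \<Psi>_cong) auto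
    then show "z1 r = y0 + integral {0..r} (\<Psi> (\<lambda>s. cutoff e2 (z1 s)))"
      using z1 r by (auto simp: sol_def)
    show "z2 r = y0 + integral {0..r} (\<Psi> (\<lambda>s. cutoff e2 (z2 s)))"
      using z2 r by (auto simp: sol_def)
  qed (use b in auto)
  have crossing: "\<exists>b. 0 \<le> b \<and> b \<le> t \<and> z b = e2" if "sol e z" "z t < e2" for z e
  proof -
    have "continuous_on {0..t} z"
      using that by (auto simp: sol_def intro: continuous_on_subset)
    then show ?thesis using IVT2'[of z t e2 0] that t e(4) sol_0[OF that(1)] by auto
  qed
  consider "e2 \<le> z1 t" "e2 \<le> z2 t" | "z1 t < e2" "e2 \<le> z2 t" | "e2 \<le> z1 t" "z2 t < e2"
    | "z1 t < e2" "z2 t < e2" by linarith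
  then show ?thesis
  proof cases
    case 1
    then show ?thesis using agree[OF t] e sol_le[OF z2 e(4) t] by (simp add: cutoff_def)
  next
    case 2
    then obtain b where b: "0 \<le> b" "b \<le> t" "z1 b = e2" using crossing[OF z1] by blast
    \<comment> \<open>Where \<open>z1\<close> crosses \<open>e2\<close> the solutions still agree,
      so \<open>z2\<close> is at the level as well and cannot be above it later.\<close>
    then have "z2 b = e2" using agree[of b] sol_decreasing[OF z2 e(4) b(1,2)] 2 by auto
    then have "z2 t = e2" using sol_decreasing[OF z2 e(4) b(1,2)] 2 by auto
    then show ?thesis using 2 e by (auto simp: cutoff_def)
  next
    case 3
    then obtain b where b: "0 \<le> b" "b \<le> t" "z2 b = e2" using crossing[OF z2] by blast
    then have "z1 b = e2" using agree[of b] sol_decreasing[OF z1 e1 b(1,2)] 3 by auto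
    then have "z1 t = e2" using sol_decreasing[OF z1 e1 b(1,2)] 3 by auto
    then show ?thesis using 3 e by (auto simp: cutoff_def)
  next
    case 4
    then show ?thesis using e by (auto simp: cutoff_def)
  qed
qed

lemma sol_unique:
  assumes "sol 0 y" "sol 0 z" "0 \<le> r"
  shows "y r = z r"
proof -
  have "cutoff 0 (y s) = cutoff 0 (z s)" if s: "0 \<le> s" for s
  proof (rule ccontr)
    assume neq: "cutoff 0 (y s) \<noteq> cutoff 0 (z s)"
    \<comment> \<open>Both truncations lie within \<open>e\<close> of that of one regularised
      solution, hence within \<open>2 * e\<close> of each other; the divisor \<open>3\<close> makes
      this a contradiction.\<close>
    define e where "e = min y0 (\<bar>cutoff 0 (y s) - cutoff 0 (z s)\<bar> / 3)"
    have e: "0 < e" "e \<le> y0"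
      using neq y0_pos by (auto simp: e_def)
    have "e \<le> \<bar>cutoff 0 (y s) - cutoff 0 (z s)\<bar> / 3"
      unfolding e_def by (rule min.cobounded2)
    moreover obtain u where u: "sol e u" using sol_exists_pos[OF e(1,2)] by blast
    ultimately show False
      using cutoff_comparison[OF assms(1) u, of s] cutoff_comparison[OF assms(2) u, of s] e s by auto
  qed
  \<comment> \<open>The truncations determine the right hand side, so the integral equation carries
    the agreement over to negative values.\<close>
  then have "integral {0..r} (\<Psi> (\<lambda>s. cutoff 0 (y s))) = integral {0..r} (\<Psi> (\<lambda>s. cutoff 0 (z s)))"
    by (intro integral_cong \<Psi>_cong) auto
  then show ?thesis using assms by (simp add: sol_def)
qed

text \<open>The comparison estimate does not depend on the radius, so the truncated solutions are
  uniformly Cauchy and their limit is continuous.\<close>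

lemma sol_exists: "\<exists>y. sol 0 y"
proof -
  define e where "e j = y0 / real (Suc j)" for j
  have e: "0 < e j" "e j \<le> y0" for j
    using y0_pos by (auto simp: e_def field_simps)
  have e_dec: "e j \<le> e i" if "i \<le> j" for i j
    unfolding e_def using that y0_pos by (intro divide_left_mono) auto
  have e_lim: "e \<longlonglongrightarrow> 0"
    unfolding e_def using LIMSEQ_Suc[OF lim_const_over_n[of y0]] by simp
  have "\<forall>j. \<exists>y. sol (e j) y" using sol_exists_pos e by blast
  then obtain y where y: "\<And>j. sol (e j) (y j)" by metis
  define \<sigma> where "\<sigma> j s = cutoff (e j) (y j s)" for j s
  have cmp: "\<bar>\<sigma> j s - \<sigma> i s\<bar> \<le> e i" if "i \<le> j" "0 \<le> s" for i j s
    unfolding \<sigma>_def using cutoff_comparison[OF y[of j] y[of i]] e e_dec that by (auto intro: less_imp_le)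
  have ad: "admissible (\<sigma> j)" for j
    unfolding \<sigma>_def using y[of j] e by (auto simp: sol_def intro: admissible_cutoff)
  have "uniformly_Cauchy_on {0..} \<sigma>"
  proof (rule uniformly_Cauchy_onI')
    fix d :: real assume "0 < d"
    then have "\<forall>\<^sub>F i in sequentially. e i < d"
      using e_lim by (intro order_tendstoD)
    then obtain N where "\<And>i. i \<ge> N \<Longrightarrow> e i < d" by (auto simp: eventually_sequentially)
    then show "\<exists>M. \<forall>x\<in>{0..}. \<forall>m\<ge>M. \<forall>n>m. dist (\<sigma> m x) (\<sigma> n x) < d"
    proof (intro exI[of _ N] ballI allI impI)
      fix x :: real and m n assume "x \<in> {0..}" "N \<le> m" "m < n"
      then show "dist (\<sigma> m x) (\<sigma> n x) < d"
        using cmp[of m n x] \<open>\<And>i. i \<ge> N \<Longrightarrow> e i < d\<close>[of m] by (simp add: dist_real_def abs_minus_commute)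
    qed
  qed
  then obtain \<tau> where unif: "uniform_limit {0..} \<sigma> \<tau> sequentially"
    using Cauchy_uniformly_convergent[of "{0..}" \<sigma>] by (auto simp: uniformly_convergent_on_def)
  have lim: "(\<lambda>j. \<sigma> j s) \<longlonglongrightarrow> \<tau> s" if "0 \<le> s" for s
    using tendsto_uniform_limitI[OF unif, of s] that by simp
  have \<tau>_cont: "continuous_on {0..} \<tau>"
    using ad by (intro uniform_limit_theorem[OF _ unif]) (auto simp: admissible_def)
  moreover have "\<tau> s \<le> y0" if "0 \<le> s" for s
    using LIMSEQ_le_const2[OF lim[OF that], of y0] ad that by (auto simp: admissible_def)
  ultimately have ad\<tau>: "admissible \<tau>" by (simp add: admissible_def)
  \<comment> \<open>As a limit of truncations \<open>\<tau>\<close> has lost all negative values;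
    integrating its right hand side once restores them. That \<open>\<tau>\<close> is the truncation
    of \<open>x\<close> then follows from continuity of \<open>max\<close> and
    \<open>min\<close>.\<close>
  define x where "x r = y0 + integral {0..r} (\<Psi> \<tau>)" for r
  have x_lim: "(\<lambda>j. y j r) \<longlonglongrightarrow> x r" if r: "0 \<le> r" for r
  proof -
    have "(\<lambda>j. integral {0..r} (\<Psi> (\<sigma> j))) \<longlonglongrightarrow> integral {0..r} (\<Psi> \<tau>)"
    proof (rule dominated_convergence(2)[where h = "\<lambda>s. B / \<delta> * s"])
      show "\<Psi> (\<sigma> j) integrable_on {0..r}" for j
        by (rule integrable_halfline[OF continuous_on_\<Psi>[OF ad]])
      show "(\<lambda>s. B / \<delta> * s) integrable_on {0..r}"
        by (intro integrable_continuous_real continuous_intros)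
      show "norm (\<Psi> (\<sigma> j) s) \<le> B / \<delta> * s" if "s \<in> {0..r}" for j s
        using \<Psi>_bound[OF ad, of s] that by simp
      show "(\<lambda>j. \<Psi> (\<sigma> j) s) \<longlonglongrightarrow> \<Psi> \<tau> s" if "s \<in> {0..r}" for s
        using \<Psi>_tendsto[OF ad ad\<tau> _ lim] that by simp
    qed
    moreover have "y j r = y0 + integral {0..r} (\<Psi> (\<sigma> j))" for j
      using y[of j] r by (simp add: sol_def \<sigma>_def[abs_def])
    ultimately show ?thesis
      by (auto simp: x_def intro: tendsto_add)
  qed
  have x_cutoff: "cutoff 0 (x s) = \<tau> s" if s: "0 \<le> s" for s
  proof -
    have "(\<lambda>j. cutoff (e j) (y j s)) \<longlonglongrightarrow> cutoff 0 (x s)"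
      unfolding cutoff_def by (intro tendsto_max tendsto_min e_lim x_lim s tendsto_const)
    then show ?thesis using LIMSEQ_unique[OF lim[OF s]] by (simp add: \<sigma>_def)
  qed
  have "x r = y0 + integral {0..r} (\<Psi> (\<lambda>s. cutoff 0 (x s)))" if "0 \<le> r" for r
    unfolding x_def[of r] by (auto intro!: integral_cong \<Psi>_cong simp: x_cutoff)
  moreover have "continuous_on {0..} x"
    unfolding x_def by (intro continuous_intros continuous_on_integral_halfline continuous_on_\<Psi> ad\<tau>)
  ultimately show ?thesis by (auto simp: sol_def)
qed

subsection \<open>Removing the cut-off\<close>

definition rhs :: "(real \<Rightarrow> real) \<Rightarrow> real \<Rightarrow> real" where
  "rhs y r = - ((ms y r / r\<^sup>2 + 4 * pi * r * H (y r)) / \<phi> y r)"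

definition star :: "(real \<Rightarrow> real) \<Rightarrow> bool" where
  "star y \<longleftrightarrow> (\<forall>r\<ge>0. (y has_real_derivative rhs y r) (at r within {0..})) \<and> y 0 = y0 \<and>
     (\<forall>r\<ge>0. y r \<le> y0) \<and> (\<forall>r>0. 0 < \<phi> y r)"

lemma \<phi>_0: "\<phi> y 0 = 1"
  by (simp add: \<phi>_def)

lemma \<phi>_le_1: "admissible y \<Longrightarrow> 0 \<le> r \<Longrightarrow> \<phi> y r \<le> 1"
  using k_nonneg ms_nonneg[of y r] by (simp add: \<phi>_def)

lemma compactness_le:
  assumes "admissible y" "0 \<le> r"
  shows "2 * k * ms y r / r \<le> 8 * pi / 3 * G y0 * r\<^sup>2"
proof (cases "r = 0")
  case False
  then have "0 < r" using assms by simp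
  have "k * ms y r \<le> 1 * ms y r"
    using k_le_1 ms_nonneg[OF assms] by (intro mult_right_mono)
  then have "2 * k * ms y r / r \<le> 2 * (4 * pi / 3 * G y0 * r ^ 3) / r"
    using ms_le[OF assms] \<open>0 < r\<close> by (intro divide_right_mono) auto
  then show ?thesis using \<open>0 < r\<close> by (simp add: power2_eq_square power3_eq_cube)
qed simp

lemma continuous_on_compactness:
  assumes "admissible y"
  shows "continuous_on {0..} (\<lambda>r. 2 * k * ms y r / r)"
proof (rule continuous_on_halfline_vanishing[where C = "8 * pi / 3 * G y0"])
  have "continuous_on {0<..} (\<lambda>r. 1 - \<phi> y r)"
    by (intro continuous_intros continuous_on_\<phi> assms)
  then show "continuous_on {0<..} (\<lambda>r. 2 * k * ms y r / r)" by (simp add: \<phi>_def)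
next
  fix r :: real assume r: "0 \<le> r" "r < 1"
  have "8 * pi / 3 * G y0 * r\<^sup>2 \<le> 8 * pi / 3 * G y0 * r"
    using r G_nonneg[of y0] by (intro mult_left_mono) (auto simp: power2_eq_square mult_left_le)
  moreover have "0 \<le> 2 * k * ms y r / r"
    using ms_nonneg[OF assms r(1)] k_nonneg r by simp
  ultimately show "\<bar>2 * k * ms y r / r\<bar> \<le> 8 * pi / 3 * G y0 * r"
    using compactness_le[OF assms r(1)] by linarith
qed

lemma continuous_on_\<phi>_closed: "admissible y \<Longrightarrow> continuous_on {0..} (\<phi> y)"
  unfolding \<phi>_def by (intro continuous_intros continuous_on_compactness)

lemma DERIV_\<phi>:
  assumes "admissible y" "0 < r"
  shows "(\<phi> y has_real_derivative - 2 * k * (4 * pi * r * G (y r) - ms y r / r\<^sup>2)) (at r)"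
proof -
  have "(ms y has_real_derivative 4 * pi * r\<^sup>2 * G (y r)) (at r)"
    using DERIV_ms[OF assms(1), of r] assms(2) at_within_halfline by simp
  then show ?thesis
    unfolding \<phi>_def using assms(2)
    by (auto intro!: derivative_eq_intros simp: power2_eq_square field_simps)
qed

text \<open>A quantitative substitute for the Buchdahl inequality: since the density decreases outwards,
  \<open>4 \<pi> r G (y r) \<le> 3 ms y r / r\<^sup>2\<close>, and hence \<open>y - ln \<phi> / 4\<close> is nonincreasing.\<close>

lemma \<phi>_exp_bound:
  assumes ad: "admissible y" and y_0: "y 0 = y0"
    and dec: "\<And>r s. 0 \<le> r \<Longrightarrow> r \<le> s \<Longrightarrow> y s \<le> y r"
    and b: "0 \<le> b" and pos: "\<And>r. 0 \<le> r \<Longrightarrow> r \<le> b \<Longrightarrow> 0 < \<phi> y r"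
    and deriv: "\<And>r. 0 < r \<Longrightarrow> r < b \<Longrightarrow>
      \<exists>d. (y has_real_derivative d) (at r) \<and> d \<le> - (ms y r / r\<^sup>2 / \<phi> y r)"
  shows "exp (4 * (y b - y0)) \<le> \<phi> y b"
proof -
  have "y b - ln (\<phi> y b) / 4 \<le> y 0 - ln (\<phi> y 0) / 4"
  proof (rule nonincreasing_Icc[where f = "\<lambda>r. y r - ln (\<phi> y r) / 4"])
    have "continuous_on {0..b} y" "continuous_on {0..b} (\<phi> y)"
      using ad continuous_on_\<phi>_closed[OF ad]
      by (auto simp: admissible_def elim!: continuous_on_subset)
    then show "continuous_on {0..b} (\<lambda>r. y r - ln (\<phi> y r) / 4)"
      using pos by (intro continuous_intros) (auto simp: less_imp_neq[symmetric])
  next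
    fix r assume r: "0 < r" "r < b"
    then obtain d where d: "(y has_real_derivative d) (at r)" "d \<le> - (ms y r / r\<^sup>2 / \<phi> y r)"
      using deriv by blast
    have p: "0 < \<phi> y r" using pos r by simp
    let ?q = "ms y r / r\<^sup>2"
    have "G (y r) \<le> G (y s)" if "0 \<le> s" "s \<le> r" for s
      using dec[OF that] ad that by (intro G_mono) (auto simp: admissible_def)
    then have "4 * pi / 3 * G (y r) * r ^ 3 \<le> ms y r"
      using ms_ge[OF ad] r by simp
    then have "4 * pi / 3 * G (y r) * r ^ 3 / r\<^sup>2 \<le> ?q" by (intro divide_right_mono) auto
    then have G3: "4 * pi * r * G (y r) \<le> 3 * ?q"
      using r by (simp add: power2_eq_square power3_eq_cube mult_ac)
    \<comment> \<open>Of the three multiples of \<open>?q\<close> one is cancelled by the mass term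
      in the derivative of \<open>\<phi>\<close>. The remaining two, with the factor
      \<open>2 * k\<close> and \<open>k \<le> 1\<close>, produce the constant
      \<open>4\<close>.\<close>
    have "- 2 * k * (4 * pi * r * G (y r) - ?q) \<ge> - 2 * k * (2 * ?q)"
      using mult_left_mono[of "4 * pi * r * G (y r) - ?q" "2 * ?q" "2 * k"] G3 k_nonneg by linarith
    moreover have "k * ?q \<le> 1 * ?q"
      using k_le_1 ms_nonneg[OF ad, of r] r by (intro mult_right_mono) auto
    ultimately have "- 4 * ?q \<le> - 2 * k * (4 * pi * r * G (y r) - ?q)" by simp
    then have "- 4 * ?q / \<phi> y r \<le> - 2 * k * (4 * pi * r * G (y r) - ?q) / \<phi> y r"
      using p by (intro divide_right_mono) auto
    then have "- 4 * (?q / \<phi> y r) \<le> - 2 * k * (4 * pi * r * G (y r) - ?q) / \<phi> y r" by simp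
    moreover have "d - z / 4 \<le> 0" if "- 4 * x \<le> z" "d \<le> - x" for x z :: real using that by linarith
    ultimately have "d - - 2 * k * (4 * pi * r * G (y r) - ?q) / \<phi> y r / 4 \<le> 0"
      using d(2) by blast
    moreover have "((\<lambda>r. y r - ln (\<phi> y r) / 4) has_real_derivative
        d - - 2 * k * (4 * pi * r * G (y r) - ?q) / \<phi> y r / 4) (at r)"
      using p by (intro DERIV_diff d(1) DERIV_cdivide)
        (auto intro!: derivative_eq_intros DERIV_\<phi>[OF ad r(1)] simp: field_simps)
    ultimately show "\<exists>d. ((\<lambda>r. y r - ln (\<phi> y r) / 4) has_real_derivative d) (at r) \<and> d \<le> 0"
      by blast
  qed (use b in auto)
  then have "4 * (y b - y0) \<le> ln (\<phi> y b)" by (simp add: y_0 \<phi>_0)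
  then show ?thesis using pos[OF b order_refl] ln_ge_iff by blast
qed

lemma vacuum_ms:
  assumes "admissible y" "0 \<le> R" "R \<le> r" and vac: "\<And>s. R \<le> s \<Longrightarrow> y s \<le> 0"
  shows "ms y r = ms y R"
proof -
  have "\<exists>d. (ms y has_real_derivative d) (at s) \<and> d \<le> 0" if "R < s" for s
    using DERIV_ms[OF assms(1), of s] at_within_halfline[of s] G_zero[OF vac[of s]] that assms(2) by auto
  then have "ms y r \<le> ms y R"
    using assms(2) by (intro nonincreasing_Icc[OF _ continuous_on_subset[OF continuous_on_ms] assms(3)])
      (auto simp: assms(1))
  then show ?thesis using ms_mono[OF assms(1-3)] by simp
qed

text \<open>A bootstrap: up to the first radius where \<open>\<phi>\<close> equals
  \<open>\<delta>\<close> the exponential bound holds and already gives \<open>2 * \<delta>\<close>.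
  The derivative is assumed only where \<open>\<phi>\<close> exceeds \<open>\<delta>\<close>,
  because there the regularised equation coincides with the true one; thus the lemma serves
  solutions of both.\<close>

lemma \<phi>_lower_bound:
  assumes ad: "admissible y" and y_0: "y 0 = y0"
    and dec: "\<And>r s. 0 \<le> r \<Longrightarrow> r \<le> s \<Longrightarrow> y s \<le> y r"
    and deriv: "\<And>r. 0 < r \<Longrightarrow> \<delta> < \<phi> y r \<Longrightarrow>
      \<exists>d. (y has_real_derivative d) (at r) \<and> d \<le> - (ms y r / r\<^sup>2 / \<phi> y r)"
    and r: "0 \<le> r"
  shows "2 * \<delta> \<le> \<phi> y r"
proof -
  have exp_ge: "2 * \<delta> \<le> exp (4 * (y b - y0))" if "0 \<le> y b" for b
    using that by (simp add: \<delta>_def)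
  have cont: "continuous_on {0..b} (\<phi> y)" for b
    by (rule continuous_on_subset[OF continuous_on_\<phi>_closed[OF ad]]) auto
  have \<delta>_1: "\<delta> < 1" using y0_pos by (simp add: \<delta>_def) (smt (verit) exp_le_one_iff)
  have gt: "\<delta> < \<phi> y b" if b: "0 \<le> b" "0 \<le> y b" for b
  proof (rule ccontr)
    assume "\<not> \<delta> < \<phi> y b"
    define S where "S = {s \<in> {0..b}. \<phi> y s = \<delta>}"
    have "closed S"
      unfolding S_def using continuous_closed_preimage_constant[OF cont, of b \<delta>] by simp
    moreover have "bounded S"
      by (rule bounded_subset[OF bounded_closed_interval[of 0 b]]) (auto simp: S_def)
    ultimately have "compact S" by (simp add: compact_eq_bounded_closed)
    moreover have "S \<noteq> {}"
      using IVT2'[of "\<phi> y" b \<delta> 0] \<open>\<not> \<delta> < \<phi> y b\<close> \<delta>_1 cont b by (auto simp: S_def \<phi>_0)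
    ultimately obtain t where t: "t \<in> S" "\<And>s. s \<in> S \<Longrightarrow> t \<le> s"
      using compact_attains_inf by metis
    have before: "\<delta> < \<phi> y s" if s: "0 \<le> s" "s < t" for s
    proof (rule ccontr)
      assume "\<not> \<delta> < \<phi> y s"
      then obtain u where "0 \<le> u" "u \<le> s" "\<phi> y u = \<delta>"
        using IVT2'[of "\<phi> y" s \<delta> 0] \<delta>_1 cont s by (auto simp: \<phi>_0)
      then show False using t(2)[of u] s t(1) by (auto simp: S_def)
    qed
    have "exp (4 * (y t - y0)) \<le> \<phi> y t"
    proof (rule \<phi>_exp_bound[OF ad y_0 dec])
      show "0 < \<phi> y s" if "0 \<le> s" "s \<le> t" for s
        using before[of s] that t(1) \<delta>_pos by (cases "s = t") (auto simp: S_def)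
      show "\<exists>d. (y has_real_derivative d) (at s) \<and> d \<le> - (ms y s / s\<^sup>2 / \<phi> y s)" if "0 < s" "s < t" for s
        using deriv before that by simp
    qed (use t in \<open>auto simp: S_def\<close>)
    moreover have "0 \<le> y t" using dec[of t b] t(1) b by (auto simp: S_def)
    ultimately show False using exp_ge[of t] t(1) \<delta>_pos by (auto simp: S_def)
  qed
  have ge: "2 * \<delta> \<le> \<phi> y b" if b: "0 \<le> b" "0 \<le> y b" for b
  proof -
    have gt': "\<delta> < \<phi> y s" if "0 \<le> s" "s \<le> b" for s
      using gt[of s] dec[of s b] that b by auto
    have "exp (4 * (y b - y0)) \<le> \<phi> y b"
    proof (rule \<phi>_exp_bound[OF ad y_0 dec b(1)])
      show "0 < \<phi> y s" if "0 \<le> s" "s \<le> b" for s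
        using gt'[OF that] \<delta>_pos by simp
      show "\<exists>d. (y has_real_derivative d) (at s) \<and> d \<le> - (ms y s / s\<^sup>2 / \<phi> y s)" if "0 < s" "s < b" for s
        using deriv gt' that by simp
    qed
    then show ?thesis using exp_ge[OF b(2)] by simp
  qed
  show ?thesis
  \<comment> \<open>For negative \<open>y r\<close> the exponential bound falls below
    \<open>2 * \<delta>\<close>. But beyond the zero the mass is constant, so \<open>\<phi>\<close>
    cannot decrease any more.\<close>
  proof (cases "0 \<le> y r")
    case False
    have "continuous_on {0..r} y" using ad by (auto simp: admissible_def elim: continuous_on_subset)
    then obtain R where R: "0 \<le> R" "R \<le> r" "y R = 0"
      using IVT2'[of y r 0 0] False y_0 y0_pos r by auto
    have "R \<noteq> 0" using R y_0 y0_pos by auto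
    have "ms y r = ms y R"
      using vacuum_ms[OF ad R(1,2)] dec[OF R(1)] R(3) by simp
    then have "\<phi> y R \<le> \<phi> y r"
      using R \<open>R \<noteq> 0\<close> k_nonneg ms_nonneg[OF ad R(1)] by (auto simp: \<phi>_def intro!: divide_left_mono)
    then show ?thesis using ge[of R] R by simp
  qed (use ge r in simp)
qed

lemma G_cutoff: "x \<le> y0 \<Longrightarrow> G (cutoff 0 x) = G x"
  using G_zero[of x] G_zero[of 0] by (auto simp: cutoff_def max_def)

lemma H_cutoff: "x \<le> y0 \<Longrightarrow> H (cutoff 0 x) = H x"
  using H_zero[of x] H_zero[of 0] by (auto simp: cutoff_def max_def)

lemma ms_cutoff: "admissible y \<Longrightarrow> ms (\<lambda>s. cutoff 0 (y s)) r = ms y r"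
  unfolding ms_def by (auto simp: admissible_def G_cutoff intro!: integral_cong)

lemma \<phi>_cutoff: "admissible y \<Longrightarrow> \<phi> (\<lambda>s. cutoff 0 (y s)) r = \<phi> y r"
  by (simp add: \<phi>_def ms_cutoff)

lemma \<Psi>_cutoff: "admissible y \<Longrightarrow> 0 \<le> r \<Longrightarrow> \<Psi> (\<lambda>s. cutoff 0 (y s)) r = \<Psi> y r"
  by (simp add: \<Psi>_def ms_cutoff \<phi>_cutoff H_cutoff admissible_def)

lemma \<Psi>_eq_rhs: "2 * \<delta> \<le> \<phi> y r \<Longrightarrow> \<Psi> y r = rhs y r"
  using \<delta>_pos by (simp add: \<Psi>_def rhs_def)

lemma sol_imp_star:
  assumes "sol 0 y"
  shows "star y" "\<And>r. 0 \<le> r \<Longrightarrow> 2 * \<delta> \<le> \<phi> y r"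
proof -
  have y0: "0 \<le> y0" using y0_pos by simp
  have ad: "admissible y"
    using assms sol_le[OF assms y0] by (simp add: sol_def admissible_def)
  have deriv: "(y has_real_derivative \<Psi> y r) (at r within {0..})" if "0 \<le> r" for r
    using DERIV_sol[OF assms y0 that] \<Psi>_cutoff[OF ad that] by simp
  show ge: "2 * \<delta> \<le> \<phi> y r" if "0 \<le> r" for r
  proof (rule \<phi>_lower_bound[OF ad sol_0[OF assms] sol_decreasing[OF assms y0] _ that])
    fix s :: real assume s: "0 < s" "\<delta> < \<phi> y s"
    then have "0 \<le> 4 * pi * s * H (y s) / \<phi> y s"
      using H_nonneg[of "y s"] ad \<delta>_pos by (auto simp: admissible_def)
    then have "\<Psi> y s \<le> - (ms y s / s\<^sup>2 / \<phi> y s)"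
      using s by (simp add: \<Psi>_def add_divide_distrib)
    then show "\<exists>d. (y has_real_derivative d) (at s) \<and> d \<le> - (ms y s / s\<^sup>2 / \<phi> y s)"
      using deriv[of s] s at_within_halfline[of s] by auto
  qed
  show "star y"
    unfolding star_def
  proof (intro conjI allI impI)
    fix r :: real assume "0 \<le> r"
    then show "(y has_real_derivative rhs y r) (at r within {0..})"
      using deriv[of r] \<Psi>_eq_rhs[OF ge] by simp
    show "y r \<le> y0" by (rule sol_le[OF assms y0 \<open>0 \<le> r\<close>])
  next
    fix r :: real assume "0 < r"
    then show "0 < \<phi> y r" using ge[of r] \<delta>_pos by simp
  qed (rule sol_0[OF assms])
qed

section \<open>Solutions of the equation without cut-off\<close>

lemma star_admissible: "star y \<Longrightarrow> admissible y"
  unfolding star_def admissible_def by (auto intro!: DERIV_continuous_on)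

lemma star_\<phi>_pos: "star y \<Longrightarrow> 0 \<le> r \<Longrightarrow> 0 < \<phi> y r"
  using \<phi>_0[of y] by (cases "r = 0") (auto simp: star_def)

lemma star_DERIV: "star y \<Longrightarrow> 0 < r \<Longrightarrow> (y has_real_derivative rhs y r) (at r)"
  using at_within_halfline[of r] unfolding star_def by (metis less_imp_le)

lemma rhs_le:
  assumes "star y" "0 \<le> r"
  shows "rhs y r \<le> - (ms y r / r\<^sup>2 / \<phi> y r)"
proof -
  have "0 \<le> 4 * pi * r * H (y r) / \<phi> y r"
    using assms star_\<phi>_pos[OF assms] H_nonneg[of "y r"] by (simp add: star_def)
  then show ?thesis by (simp add: rhs_def add_divide_distrib)
qed

lemma rhs_le_Newton:
  assumes "star y" "0 \<le> r"
  shows "rhs y r \<le> - (ms y r / r\<^sup>2)"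
proof -
  have "ms y r / r\<^sup>2 / 1 \<le> ms y r / r\<^sup>2 / \<phi> y r"
    using star_\<phi>_pos[OF assms] \<phi>_le_1[OF star_admissible[OF assms(1)] assms(2)]
      ms_nonneg[OF star_admissible[OF assms(1)] assms(2)]
    by (intro divide_left_mono) auto
  then show ?thesis using rhs_le[OF assms] by simp
qed

lemma star_decreasing:
  assumes "star y" "0 \<le> r" "r \<le> s"
  shows "y s \<le> y r"
proof (rule nonincreasing_Icc[where f = y and a = r and b = s])
  fix x assume "r < x" "x < s"
  moreover have "rhs y x \<le> 0"
    using rhs_le_Newton[OF assms(1), of x] ms_nonneg[OF star_admissible[OF assms(1)], of x] assms(2) \<open>r < x\<close>
    by (auto intro: order_trans)
  ultimately show "\<exists>d. (y has_real_derivative d) (at x) \<and> d \<le> 0"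
    using star_DERIV[OF assms(1), of x] assms(2) by auto
next
  show "continuous_on {r..s} y"
    using star_admissible[OF assms(1)] assms(2)
    by (auto simp: admissible_def elim!: continuous_on_subset)
qed (rule assms(3))

text \<open>This direction carries uniqueness: every true solution obeys the same barrier, hence
  solves the regularised equation, to which \<open>sol_unique\<close> applies.\<close>

lemma star_imp_sol:
  assumes "star y"
  shows "sol 0 y"
proof -
  have ad: "admissible y" by (rule star_admissible[OF assms])
  have ge: "2 * \<delta> \<le> \<phi> y r" if "0 \<le> r" for r
  proof (rule \<phi>_lower_bound[OF ad _ star_decreasing[OF assms] _ that])
    show "y 0 = y0" using assms by (simp add: star_def)
    show "\<exists>d. (y has_real_derivative d) (at s) \<and> d \<le> - (ms y s / s\<^sup>2 / \<phi> y s)" if "0 < s" for s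
      using star_DERIV[OF assms that] rhs_le[OF assms, of s] that by auto
  qed
  have "y r = y0 + integral {0..r} (\<Psi> (\<lambda>s. cutoff 0 (y s)))" if r: "0 \<le> r" for r
  proof -
    have "(rhs y has_integral y r - y 0) {0..r}"
      using assms r by (intro integral_DERIV_halfline) (auto simp: star_def)
    moreover have "integral {0..r} (\<Psi> (\<lambda>s. cutoff 0 (y s))) = integral {0..r} (rhs y)"
      using ge by (intro integral_cong) (simp add: \<Psi>_cutoff[OF ad] \<Psi>_eq_rhs)
    ultimately show ?thesis using assms by (simp add: star_def integral_unique)
  qed
  then show ?thesis using ad by (simp add: sol_def admissible_def)
qed

lemma star_\<phi>_ge: "star y \<Longrightarrow> 0 \<le> r \<Longrightarrow> 2 * \<delta> \<le> \<phi> y r"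
  by (rule sol_imp_star(2)[OF star_imp_sol])

lemma star_exists: "\<exists>y. star y"
  using sol_exists sol_imp_star by blast

lemma star_unique: "star y \<Longrightarrow> star z \<Longrightarrow> 0 \<le> r \<Longrightarrow> y r = z r"
  using sol_unique star_imp_sol by blast

lemma continuous_on_rhs: "star y \<Longrightarrow> continuous_on {0..} (rhs y)"
  by (rule continuous_on_eq[OF continuous_on_\<Psi>[OF star_admissible]])
    (auto simp: \<Psi>_eq_rhs star_\<phi>_ge)

lemma star_IVT:
  assumes "star y" "0 \<le> r" "y r \<le> x" "x \<le> y0"
  obtains b where "0 \<le> b" "b \<le> r" "y b = x"
proof -
  have "continuous_on {0..r} y"
    using star_admissible[OF assms(1)] by (auto simp: admissible_def elim!: continuous_on_subset)
  then show ?thesis using IVT2'[of y r x 0] assms that by (auto simp: star_def)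
qed

lemma ms_pos:
  assumes "star y" "0 < r"
  shows "0 < ms y r"
proof -
  have ad: "admissible y" by (rule star_admissible[OF assms(1)])
  obtain s where s: "0 < s" "s \<le> r" "0 < y s"
  proof (cases "0 < y r")
    case False
    then obtain b where "0 \<le> b" "b \<le> r" "y b = y0 / 2"
      using star_IVT[OF assms(1), of r "y0 / 2"] assms(2) y0_pos by auto
    moreover from this have "b \<noteq> 0" using assms(1) y0_pos by (auto simp: star_def)
    ultimately show ?thesis using that[of b] y0_pos by simp
  qed (use assms that in auto)
  have "0 < G (y s)" using s ad by (auto simp: admissible_def intro!: G_pos)
  moreover have "4 * pi / 3 * G (y s) * s ^ 3 \<le> ms y s"
    using ad s star_decreasing[OF assms(1)] by (intro ms_ge) (auto simp: admissible_def intro!: G_mono)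
  moreover from calculation(1) have "0 < 4 * pi / 3 * G (y s) * s ^ 3" using s by simp
  ultimately have "0 < ms y s" by linarith
  then show ?thesis using ms_mono[OF ad, of s r] s by simp
qed

text \<open>The mass is positive at every positive radius, in the vacuum region too, so
  \<open>y\<close> keeps falling there. This makes the zero unique.\<close>

lemma star_strictly_decreasing:
  assumes "star y" "0 \<le> r" "r < s"
  shows "y s < y r"
proof (rule DERIV_neg_imp_decreasing_open[OF assms(3)])
  fix x assume "r < x" "x < s"
  then have "rhs y x < 0"
    using rhs_le_Newton[OF assms(1), of x] ms_pos[OF assms(1), of x] assms(2)
    by (auto intro: le_less_trans)
  then show "\<exists>d. (y has_real_derivative d) (at x) \<and> d < 0"
    using star_DERIV[OF assms(1), of x] assms(2) \<open>r < x\<close> by auto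
next
  show "continuous_on {r..s} y"
    using star_admissible[OF assms(1)] assms(2)
    by (auto simp: admissible_def elim!: continuous_on_subset)
qed

text \<open>If \<open>y\<close> stayed positive, then \<open>y' \<le> - C r y\<^sup>n\<close> would force decay like
  \<open>r powr (- 2 / (n - 1))\<close>, which for \<open>n < 3\<close> is faster than the lower bound of order \<open>1 / r\<close>
  coming from \<open>y' \<le> - ms y 1 / r\<^sup>2\<close>.\<close>

lemma star_has_zero:
  assumes y: "star y" and K: "0 < K" and n: "1 < n" "n < 3"
    and G_ge: "\<And>x. 0 < x \<Longrightarrow> x \<le> y0 \<Longrightarrow> K * x powr n \<le> G x"
  obtains R where "0 < R" "y R = 0"
proof -
  have ad: "admissible y" by (rule star_admissible[OF y])
  have "\<exists>r\<ge>0. y r \<le> 0"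
  proof (rule ccontr)
    assume "\<not> (\<exists>r\<ge>0. y r \<le> 0)"
    then have pos: "0 < y r" if "0 \<le> r" for r using that by (meson not_le)
    define A where "A = ms y 1"
    \<comment> \<open>From \<open>y' \<le> - (4 * pi / 3) * K * s * y powr n\<close> the derivative
      of \<open>y powr (1 - n)\<close> is at least \<open>2 * c * s\<close>, which integrates to
      \<open>c * s\<^sup>2\<close>.\<close>
    define c where "c = (n - 1) * (4 * pi / 3 * K) / 2"
    have A: "0 < A" using ms_pos[OF y, of 1] by (simp add: A_def)
    have c: "0 < c" using n K by (simp add: c_def)
    have upper: "c * r\<^sup>2 \<le> y r powr (1 - n)" if r: "0 \<le> r" for r
    proof -
      have "c * r\<^sup>2 - y r powr (1 - n) \<le> c * 0\<^sup>2 - y 0 powr (1 - n)"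
      proof (rule nonincreasing_Icc[where f = "\<lambda>r. c * r\<^sup>2 - y r powr (1 - n)", OF _ _ r])
        have "continuous_on {0..r} y" using ad by (auto simp: admissible_def elim!: continuous_on_subset)
        then show "continuous_on {0..r} (\<lambda>r. c * r\<^sup>2 - y r powr (1 - n))"
          using pos by (intro continuous_intros) (auto simp: less_imp_neq[symmetric])
      next
        fix s assume s: "0 < s" "s < r"
        have "G (y s) \<le> G (y t)" if "0 \<le> t" "t \<le> s" for t
          using star_decreasing[OF y that] ad that by (auto simp: admissible_def intro!: G_mono)
        then have "4 * pi / 3 * G (y s) * s ^ 3 \<le> ms y s" using ms_ge[OF ad] s by simp
        then have "4 * pi / 3 * G (y s) * s ^ 3 / s\<^sup>2 \<le> ms y s / s\<^sup>2" by (intro divide_right_mono) auto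
        then have "4 * pi / 3 * G (y s) * s \<le> ms y s / s\<^sup>2"
          using s by (simp add: power2_eq_square power3_eq_cube)
        moreover have "4 * pi / 3 * (K * y s powr n) * s \<le> 4 * pi / 3 * G (y s) * s"
          using G_ge[of "y s"] pos[of s] s ad by (intro mult_right_mono mult_left_mono) (auto simp: admissible_def)
        ultimately have "rhs y s \<le> - (4 * pi / 3 * (K * y s powr n) * s)"
          using rhs_le_Newton[OF y, of s] s by linarith
        then have "((n - 1) * y s powr (- n)) * rhs y s
            \<le> ((n - 1) * y s powr (- n)) * (- (4 * pi / 3 * (K * y s powr n) * s))"
          using n by (intro mult_left_mono) auto
        also have "\<dots> = - (2 * c * s) * (y s powr (- n) * y s powr n)"
          by (simp add: c_def)
        also have "y s powr (- n) * y s powr n = 1"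
          using pos[of s] s by (simp flip: powr_add)
        finally have "2 * c * s + (n - 1) * y s powr (- n) * rhs y s \<le> 0" by simp
        moreover have "((\<lambda>r. c * r\<^sup>2 - y r powr (1 - n)) has_real_derivative
            c * (2 * s) - (1 - n) * y s powr (1 - n - 1) * rhs y s) (at s)"
          using pos[of s] s
          by (auto intro!: derivative_eq_intros has_real_derivative_powr' star_DERIV[OF y])
        ultimately show "\<exists>d. ((\<lambda>r. c * r\<^sup>2 - y r powr (1 - n)) has_real_derivative d) (at s) \<and> d \<le> 0"
          by (auto intro!: exI simp: algebra_simps)
      qed
      then have "c * r\<^sup>2 - y r powr (1 - n) \<le> - (y 0 powr (1 - n))" by simp
      then show ?thesis using powr_ge_zero[of "y 0" "1 - n"] by linarith
    qed
    have lower: "A / r \<le> y r" if r: "1 \<le> r" for r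
    proof (rule ccontr)
      assume "\<not> A / r \<le> y r"
      then have gap: "0 < A / r - y r" by simp
      \<comment> \<open>A gap between \<open>A / r\<close> and \<open>y r\<close> cannot shrink
        outwards. At this \<open>s\<close> the term \<open>A / s\<close> is no larger than the gap,
        so \<open>y s\<close> is no longer positive.\<close>
      define s where "s = r + A / (A / r - y r)"
      have s: "r \<le> s" "A / (A / r - y r) \<le> s" using A gap r by (auto simp: s_def)
      have "y s - A / s \<le> y r - A / r"
      proof (rule nonincreasing_Icc[where f = "\<lambda>r. y r - A / r", OF _ _ s(1)])
        have "continuous_on {r..s} y" using ad r by (auto simp: admissible_def elim!: continuous_on_subset)
        then show "continuous_on {r..s} (\<lambda>r. y r - A / r)" using r by (intro continuous_intros) auto
      next
        fix x assume x: "r < x" "x < s"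
        have "A / x\<^sup>2 \<le> ms y x / x\<^sup>2"
          unfolding A_def using x r by (intro divide_right_mono ms_mono[OF ad]) auto
        then have "rhs y x + A / x\<^sup>2 \<le> 0" using rhs_le_Newton[OF y, of x] x r by simp
        moreover have "((\<lambda>r. y r - A / r) has_real_derivative rhs y x + A / x\<^sup>2) (at x)"
          using x r by (auto intro!: derivative_eq_intros star_DERIV[OF y] simp: power2_eq_square)
        ultimately show "\<exists>d. ((\<lambda>r. y r - A / r) has_real_derivative d) (at x) \<and> d \<le> 0" by blast
      qed
      moreover have "A / s \<le> A / r - y r"
        using s gap A r by (simp add: field_simps)
      ultimately have "y s \<le> 0" by simp
      then show False using pos[of s] s r by simp
    qed
    \<comment> \<open>Together the two bounds say
      \<open>c * r powr (3 - n) \<le> A powr (1 - n)\<close>. The radius solves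
      \<open>r powr (3 - n) = X\<close> for an \<open>X\<close> too large for this; the
      \<open>max\<close> with \<open>1\<close> ensures \<open>1 \<le> r\<close>, where the lower
      bound is available.\<close>
    define X where "X = max 1 (A powr (1 - n) / c) + 1"
    define r where "r = X powr (1 / (3 - n))"
    have X: "1 \<le> X" "A powr (1 - n) / c < X" by (auto simp: X_def)
    have r: "1 \<le> r" using X n by (simp add: r_def ge_one_powr_ge_zero)
    have rp: "r powr (3 - n) = X" using n X by (simp add: r_def powr_powr)
    have "c * r\<^sup>2 \<le> y r powr (1 - n)" using upper[of r] r by simp
    also have "\<dots> \<le> (A / r) powr (1 - n)"
      using lower[OF r] A r n by (intro powr_mono2') auto
    also have "\<dots> = A powr (1 - n) / r powr (1 - n)"
      using A r by (simp add: powr_divide)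
    finally have "c * r\<^sup>2 * r powr (1 - n) \<le> A powr (1 - n)"
      using r by (simp add: pos_le_divide_eq)
    moreover have "r\<^sup>2 * r powr (1 - n) = X"
    proof -
      have "r\<^sup>2 = r powr 2" using r by (simp add: powr_numeral)
      then have "r\<^sup>2 * r powr (1 - n) = r powr (2 + (1 - n))" by (simp only: powr_add)
      then show ?thesis using rp by simp
    qed
    ultimately have "c * X \<le> A powr (1 - n)" by (simp add: mult.assoc)
    then show False using X(2) c by (simp add: pos_divide_less_eq mult.commute)
  qed
  then obtain r where "0 \<le> r" "y r \<le> 0" by blast
  then obtain R where R: "0 \<le> R" "y R = 0" using star_IVT[OF y, of r 0] y0_pos by auto
  moreover have "R \<noteq> 0" using R y y0_pos by (auto simp: star_def)
  ultimately show ?thesis using that[of R] by simp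
qed

section \<open>The boundary radius and the exterior\<close>

lemma star_zero_unique: "star y \<Longrightarrow> 0 \<le> R \<Longrightarrow> y R = 0 \<Longrightarrow> 0 \<le> r \<Longrightarrow> y r = 0 \<longleftrightarrow> r = R"
  using star_strictly_decreasing[of y r R] star_strictly_decreasing[of y R r]
  by (cases r R rule: linorder_cases) auto

lemma star_exterior_ms:
  assumes "star y" "0 \<le> R" "y R = 0" "R \<le> r"
  shows "ms y r = ms y R"
  using vacuum_ms[OF star_admissible[OF assms(1)] assms(2,4)] star_decreasing[OF assms(1,2)] assms(3)
  by simp

text \<open>In the exterior the mass is constant, the pressure term vanishes and
  \<open>\<phi>\<close> is at least \<open>2 * \<delta>\<close>. Hence \<open>y'\<close> is bounded
  by the integrable function \<open>C / r\<^sup>2\<close>.\<close>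

lemma star_convergent:
  assumes y: "star y" and R: "0 < R" "y R = 0"
  shows "\<exists>l. (y \<longlongrightarrow> l) at_top"
proof -
  have ad: "admissible y" by (rule star_admissible[OF y])
  define C where "C = ms y R / (2 * \<delta>)"
  have C: "0 \<le> C" using ms_nonneg[OF ad, of R] R \<delta>_pos by (simp add: C_def)
  have far: "- C / R \<le> y r" if r: "R \<le> r" for r
  proof -
    have "C / r - y r \<le> C / R - y R"
    proof (rule nonincreasing_Icc[where f = "\<lambda>r. C / r - y r", OF _ _ r])
      have "continuous_on {R..r} y" using ad R by (auto simp: admissible_def elim!: continuous_on_subset)
      then show "continuous_on {R..r} (\<lambda>r. C / r - y r)" using R by (intro continuous_intros) auto
    next
      fix x assume x: "R < x" "x < r"
      have "y x \<le> 0" using star_decreasing[OF y, of R x] x R by simp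
      then have "rhs y x = - (ms y R / x\<^sup>2 / \<phi> y x)"
        using star_exterior_ms[OF y _ R(2), of x] x R by (simp add: rhs_def H_zero)
      moreover have "ms y R / x\<^sup>2 / \<phi> y x \<le> ms y R / x\<^sup>2 / (2 * \<delta>)"
        using star_\<phi>_ge[OF y, of x] x R \<delta>_pos ms_nonneg[OF ad, of R] by (intro divide_left_mono) auto
      ultimately have "- C / x\<^sup>2 - rhs y x \<le> 0" by (simp add: C_def mult.commute)
      moreover have "((\<lambda>r. C / r - y r) has_real_derivative - C / x\<^sup>2 - rhs y x) (at x)"
        using x R by (auto intro!: derivative_eq_intros star_DERIV[OF y] simp: power2_eq_square)
      ultimately show "\<exists>d. ((\<lambda>r. C / r - y r) has_real_derivative d) (at x) \<and> d \<le> 0" by blast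
    qed
    moreover have "0 \<le> C / r" using C r R by simp
    ultimately show ?thesis using R(2) by simp
  qed
  show ?thesis
  proof (rule nonincreasing_bounded_convergent[where b = "- C / R"])
    fix r :: real assume "0 \<le> r"
    then show "- C / R \<le> y r"
      using far[of "max r R"] star_decreasing[OF y, of r "max r R"] by simp
  qed (rule star_decreasing[OF y])
qed

text \<open>This is \<open>4 * pi / 3\<close> times the mean density of the ball of radius
  \<open>r\<close>. In the Newtonian model it equals \<open>U' / r\<close>, the coefficient
  \<open>a\<close> of \<open>laplacian_radial\<close>.\<close>

definition mean_density :: "(real \<Rightarrow> real) \<Rightarrow> real \<Rightarrow> real" where
  "mean_density y r = (if r = 0 then 4 * pi / 3 * G y0 else ms y r / r ^ 3)"

text \<open>As the density decreases outwards, its mean is squeezed between the value at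
  \<open>r\<close> and the central value, which gives the limit at the center.\<close>

lemma continuous_on_mean_density:
  assumes y: "star y"
  shows "continuous_on {0..} (mean_density y)"
proof -
  have ad: "admissible y" by (rule star_admissible[OF y])
  have upper: "mean_density y r \<le> 4 * pi / 3 * G y0" if "0 \<le> r" for r
    using ms_le[OF ad that] that by (auto simp: mean_density_def pos_divide_le_eq)
  have lower: "4 * pi / 3 * G (y r) \<le> mean_density y r" if r: "0 \<le> r" for r
  proof (cases "r = 0")
    case True
    then show ?thesis using y by (simp add: mean_density_def star_def)
  next
    case False
    have "G (y r) \<le> G (y s)" if "0 \<le> s" "s \<le> r" for s
      using star_decreasing[OF y that] ad that by (auto simp: admissible_def intro!: G_mono)
    then show ?thesis using ms_ge[OF ad r] False r by (simp add: mean_density_def pos_le_divide_eq)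
  qed
  have bound: "\<bar>mean_density y r - 4 * pi / 3 * G y0\<bar> \<le> 4 * pi / 3 * G y0 - 4 * pi / 3 * G (y r)" if "0 \<le> r" for r
    using upper[OF that] lower[OF that] by linarith
  have G_lim: "((\<lambda>r. G (y r)) \<longlongrightarrow> G y0) (at 0 within {0..})"
    using continuous_on_G_admissible[OF ad] y by (auto simp: continuous_on_def star_def)
  have "((\<lambda>r. mean_density y r - 4 * pi / 3 * G y0) \<longlongrightarrow> 0) (at 0 within {0..})"
  proof (rule Lim_null_comparison)
    show "\<forall>\<^sub>F r in at 0 within {0..}.
        norm (mean_density y r - 4 * pi / 3 * G y0) \<le> 4 * pi / 3 * G y0 - 4 * pi / 3 * G (y r)"
      using bound by (auto simp: eventually_at_filter)
    show "((\<lambda>r. 4 * pi / 3 * G y0 - 4 * pi / 3 * G (y r)) \<longlongrightarrow> 0) (at 0 within {0..})"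
      using tendsto_diff[OF tendsto_const[of "4 * pi / 3 * G y0"]
          tendsto_mult[OF tendsto_const[of "4 * pi / 3"] G_lim]] by simp
  qed
  then have "(mean_density y \<longlongrightarrow> 4 * pi / 3 * G y0) (at 0 within {0..})"
    by (rule LIM_zero_cancel)
  moreover have "mean_density y 0 = 4 * pi / 3 * G y0" by (simp add: mean_density_def)
  ultimately have "(mean_density y \<longlongrightarrow> mean_density y 0) (at 0 within {0..})" by (simp only:)
  moreover have "isCont (mean_density y) r" if "0 < r" for r
  proof -
    have "continuous_on {0<..} (\<lambda>r. ms y r / r ^ 3)"
      by (intro continuous_intros continuous_on_subset[OF continuous_on_ms[OF ad]]) auto
    then have "continuous_on {0<..} (mean_density y)"
      by (rule continuous_on_eq) (simp add: mean_density_def)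
    then show ?thesis using continuous_on_eq_continuous_at[OF open_greaterThan] that by blast
  qed
  ultimately show ?thesis
    unfolding continuous_on_eq_continuous_within
    by (metis atLeast_iff continuous_at_imp_continuous_within continuous_within le_less)
qed

lemma DERIV_mean_density:
  assumes y: "star y" and r: "0 < r"
  shows "(mean_density y has_real_derivative (4 * pi * G (y r) - 3 * mean_density y r) / r) (at r)"
proof -
  have "(ms y has_real_derivative 4 * pi * r\<^sup>2 * G (y r)) (at r)"
    using DERIV_ms[OF star_admissible[OF y], of r] r at_within_halfline by simp
  then have "((\<lambda>r. ms y r / r ^ 3) has_real_derivative (4 * pi * G (y r) - 3 * (ms y r / r ^ 3)) / r) (at r)"
    using r by (auto intro!: derivative_eq_intros simp: field_simps power2_eq_square power3_eq_cube)
  then have "((\<lambda>r. ms y r / r ^ 3) has_real_derivative (4 * pi * G (y r) - 3 * mean_density y r) / r) (at r)"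
    using r by (simp add: mean_density_def)
  then show ?thesis
    by (rule has_field_derivative_transform_within_open[OF _ open_greaterThan[of 0]])
      (use r in \<open>auto simp: mean_density_def\<close>)
qed

definition \<phi>' :: "(real \<Rightarrow> real) \<Rightarrow> real \<Rightarrow> real" where
  "\<phi>' y r = - 2 * k * (4 * pi * r * G (y r) - ms y r / r\<^sup>2)"

text \<open>At the center \<open>1 - \<phi>\<close> is of order \<open>r\<^sup>2\<close> by
  \<open>compactness_le\<close>, so the one-sided slope is \<open>0\<close>; division by zero gives
  \<open>\<phi>'\<close> the same value.\<close>

lemma DERIV_\<phi>_closed:
  assumes ad: "admissible y" and r: "0 \<le> r"
  shows "(\<phi> y has_real_derivative \<phi>' y r) (at r within {0..})"
proof (cases "r = 0")
  case True
  have "((\<lambda>r. (\<phi> y r - \<phi> y 0) / (r - 0)) \<longlongrightarrow> 0) (at 0 within {0..})"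
  proof (rule Lim_null_comparison)
    have "norm ((\<phi> y s - \<phi> y 0) / (s - 0)) \<le> 8 * pi / 3 * G y0 * s" if "0 < s" for s
    proof -
      have "\<bar>\<phi> y s - \<phi> y 0\<bar> \<le> 8 * pi / 3 * G y0 * s\<^sup>2"
        using compactness_le[OF ad, of s] ms_nonneg[OF ad, of s] k_nonneg that
        by (simp add: \<phi>_def)
      then have "\<bar>\<phi> y s - \<phi> y 0\<bar> / s \<le> 8 * pi / 3 * G y0 * s\<^sup>2 / s"
        using that by (intro divide_right_mono) auto
      then show ?thesis using that by (simp add: power2_eq_square abs_divide)
    qed
    then show "\<forall>\<^sub>F s in at 0 within {0..}. norm ((\<phi> y s - \<phi> y 0) / (s - 0)) \<le> 8 * pi / 3 * G y0 * s"
      by (auto simp: eventually_at_filter)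
    show "((\<lambda>s. 8 * pi / 3 * G y0 * s) \<longlongrightarrow> 0) (at 0 within {0..})"
      by (auto intro!: tendsto_eq_intros)
  qed
  then show ?thesis using True by (simp add: has_field_derivative_iff \<phi>'_def)
next
  case False
  then show ?thesis
    using DERIV_\<phi>[OF ad, of r] r by (simp add: \<phi>'_def at_within_halfline)
qed

lemma continuous_on_\<phi>':
  assumes ad: "admissible y"
  shows "continuous_on {0..} (\<phi>' y)"
proof (rule continuous_on_halfline_vanishing)
  show "continuous_on {0<..} (\<phi>' y)"
    unfolding \<phi>'_def
    by (intro continuous_intros continuous_on_subset[OF continuous_on_ms[OF ad]]
        continuous_on_subset[OF continuous_on_G_admissible[OF ad]]) auto
next
  fix r :: real assume r: "0 \<le> r"
  have "4 * pi * r * G (y r) \<le> 4 * pi * r * G y0" "0 \<le> 4 * pi * r * G (y r)"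
    using ad r G_nonneg[of "y r"] by (auto simp: admissible_def intro!: mult_left_mono G_mono)
  moreover have "ms y r / r\<^sup>2 \<le> B * r" "0 \<le> ms y r / r\<^sup>2"
    using numerator_le[OF ad r] ms_nonneg[OF ad r] H_nonneg[of "y r"] ad r
    by (auto simp: admissible_def intro: order_trans[rotated])
  ultimately have "\<bar>4 * pi * r * G (y r) - ms y r / r\<^sup>2\<bar> \<le> 4 * pi * r * G y0 + B * r" by linarith
  then have "2 * k * \<bar>4 * pi * r * G (y r) - ms y r / r\<^sup>2\<bar> \<le> 2 * k * (4 * pi * r * G y0 + B * r)"
    using k_nonneg by (intro mult_left_mono) auto
  moreover have "\<bar>\<phi>' y r\<bar> = 2 * k * \<bar>4 * pi * r * G (y r) - ms y r / r\<^sup>2\<bar>"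
    unfolding \<phi>'_def abs_mult using k_nonneg by simp
  moreover have "2 * k * (4 * pi * r * G y0 + B * r) = (2 * k * (4 * pi * G y0 + B)) * r"
    by (simp add: algebra_simps)
  ultimately show "\<bar>\<phi>' y r\<bar> \<le> (2 * k * (4 * pi * G y0 + B)) * r" by simp
qed

lemma \<phi>_tendsto:
  assumes y: "star y" and R: "0 < R" "y R = 0"
  shows "(\<phi> y \<longlongrightarrow> 1) at_top"
proof -
  have "((\<lambda>r. 1 - 2 * k * ms y R / r) \<longlongrightarrow> 1 - 0) at_top"
    by (intro tendsto_diff tendsto_const tendsto_divide_0[OF tendsto_const]
        filterlim_at_top_imp_at_infinity filterlim_ident)
  moreover have "\<forall>\<^sub>F r in at_top. 1 - 2 * k * ms y R / r = \<phi> y r"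
  proof (rule eventually_at_top_linorderI[of R])
    fix r assume "R \<le> r"
    then have "ms y r = ms y R" by (intro star_exterior_ms[OF y less_imp_le[OF R(1)] R(2)])
    then show "1 - 2 * k * ms y R / r = \<phi> y r" by (simp only: \<phi>_def)
  qed
  ultimately have "(\<phi> y \<longlongrightarrow> 1 - 0) at_top" by (rule Lim_transform_eventually)
  then show ?thesis by simp
qed

end

subsection \<open>The equation of state\<close>

lemma C1_lipschitz:
  fixes f f' :: "real \<Rightarrow> real"
  assumes deriv: "\<And>x. x \<in> {a..b} \<Longrightarrow> (f has_real_derivative f' x) (at x)"
    and cont: "continuous_on {a..b} f'"
  shows "\<exists>L\<ge>0. \<forall>x\<in>{a..b}. \<forall>z\<in>{a..b}. \<bar>f x - f z\<bar> \<le> L * \<bar>x - z\<bar>"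
proof -
  have "bounded (f' ` {a..b})"
    by (intro compact_imp_bounded compact_continuous_image cont) simp
  then obtain L where L: "0 < L" "\<And>x. x \<in> {a..b} \<Longrightarrow> norm (f' x) \<le> L"
    by (auto simp: bounded_pos)
  have "norm (f x - f z) \<le> L * norm (x - z)" if "x \<in> {a..b}" "z \<in> {a..b}" for x z
    by (rule field_differentiable_bound[where S = "{a..b}", OF _ has_field_derivative_at_within[OF deriv] L(2)])
      (use that in auto)
  then show ?thesis using L(1) by (intro exI[of _ L]) auto
qed

locale equation_of_state =
  fixes M :: model and P P' :: "real \<Rightarrow> real"
  assumes P_C1: "C1_halfline P P'"
    and P'_pos: "\<And>s. s > 0 \<Longrightarrow> P' s > 0"
    and P_nonneg: "\<And>s. M = EE \<Longrightarrow> s \<ge> 0 \<Longrightarrow> P s \<ge> 0"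
    and P_zero: "M = EE \<Longrightarrow> P 0 = 0"
    and integral_finite: "Q_integrand M P P' integrable_on {0..1}"
begin

text \<open>Pressure gravitates only in the relativistic model.\<close>

definition active :: "real \<Rightarrow> real" where
  "active s = (if M = EE then P s else 0)"

definition coupling :: real where
  "coupling = (if M = EE then 1 else 0)"

abbreviation "Qf \<equiv> Q M P P'"
abbreviation "gf \<equiv> g M P P'"
abbreviation "ymax \<equiv> y_max M P P'"

lemma active_nonneg: "0 \<le> s \<Longrightarrow> 0 \<le> active s"
  using P_nonneg by (simp add: active_def)

lemma active_0: "active 0 = 0"
  using P_zero by (simp add: active_def)

lemma DERIV_P: "0 < s \<Longrightarrow> (P has_real_derivative P' s) (at s)"
  using P_C1 at_within_halfline[of s] unfolding C1_halfline_def by (metis less_imp_le)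

lemma continuous_on_P: "continuous_on {0..} P"
  using P_C1 by (auto simp: C1_halfline_def intro: DERIV_continuous_on)

lemma continuous_on_P': "continuous_on {0..} P'"
  using P_C1 by (simp add: C1_halfline_def)

lemma continuous_on_active: "continuous_on {0..} active"
  unfolding active_def by (cases "M = EE") (auto simp: continuous_on_P)

lemma P_mono: "0 \<le> s \<Longrightarrow> s \<le> t \<Longrightarrow> P s \<le> P t"
proof -
  assume s: "0 \<le> s" "s \<le> t"
  have "continuous_on {s..t} P" by (rule continuous_on_subset[OF continuous_on_P]) (use s in auto)
  moreover have "\<exists>d. (P has_real_derivative d) (at x) \<and> 0 \<le> d" if "s < x" for x
    using DERIV_P[of x] P'_pos[of x] s that by auto
  ultimately show "P s \<le> P t"
    using DERIV_nonneg_imp_increasing_open[OF s(2), of P] by blast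
qed

lemma active_mono: "0 \<le> s \<Longrightarrow> s \<le> t \<Longrightarrow> active s \<le> active t"
  by (simp add: active_def P_mono)

lemma Q_integrand_eq: "Q_integrand M P P' s = P' s / (s + active s)"
  unfolding active_def by (cases M) auto

lemma denominator_pos: "0 < s \<Longrightarrow> 0 < s + active s"
  using active_nonneg[of s] by simp

lemma continuous_on_Q_integrand: "continuous_on {0<..} (Q_integrand M P P')"
proof -
  have "continuous_on {0<..} (\<lambda>s. P' s / (s + active s))"
    by (intro continuous_intros continuous_on_subset[OF continuous_on_P']
        continuous_on_subset[OF continuous_on_active]) (auto dest: denominator_pos)
  then show ?thesis by (simp add: Q_integrand_eq[abs_def])
qed

lemma Q_integrand_integrable: "Q_integrand M P P' integrable_on {0..b}"
proof (cases "b \<le> 1")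
  case True
  then show ?thesis using integrable_subinterval_real[OF integral_finite, of 0 b] by auto
next
  case False
  have "Q_integrand M P P' integrable_on {1..b}"
    by (intro integrable_continuous_real continuous_on_subset[OF continuous_on_Q_integrand]) auto
  then show ?thesis
    using Henstock_Kurzweil_Integration.integrable_combine[OF _ _ integral_finite] False by auto
qed

section \<open>The function \<open>Q\<close> and its range\<close>

lemma Q_0: "Qf 0 = 0"
  by (simp add: Q_def)

text \<open>Integrals over empty intervals are \<open>0\<close>; this makes \<open>Qf\<close>
  monotone on the whole line, so the supremum in \<open>y_max_eq\<close> may range over all
  reals.\<close>

lemma Q_nonpos: "\<rho> \<le> 0 \<Longrightarrow> Qf \<rho> = 0"
  by (cases "\<rho> = 0") (auto simp: Q_def)

lemma continuous_on_Q: "continuous_on {0..b} Qf"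
  unfolding Q_def by (rule indefinite_integral_continuous_1[OF Q_integrand_integrable])

lemma DERIV_Q:
  assumes "0 < \<rho>"
  shows "(Qf has_real_derivative P' \<rho> / (\<rho> + active \<rho>)) (at \<rho>)"
proof -
  have "isCont (Q_integrand M P P') \<rho>"
    using continuous_on_Q_integrand continuous_on_eq_continuous_at[OF open_greaterThan] assms by blast
  then have "continuous (at \<rho> within {0..\<rho> + 1}) (Q_integrand M P P')"
    by (rule continuous_at_imp_continuous_within)
  then have "((\<lambda>u. integral {0..u} (Q_integrand M P P')) has_vector_derivative Q_integrand M P P' \<rho>)
      (at \<rho> within {0..\<rho> + 1})"
    using assms by (intro integral_has_vector_derivative_continuous_at[of _ 0 "\<rho> + 1" _ "{}", simplified]
        Q_integrand_integrable) auto
  moreover have "at \<rho> within {0..\<rho> + 1} = at \<rho>"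
    using assms by (intro at_within_interior) simp
  ultimately show ?thesis
    by (simp add: Q_def[abs_def] has_real_derivative_iff_has_vector_derivative Q_integrand_eq)
qed

lemma Q_strict_mono: "0 \<le> \<rho> \<Longrightarrow> \<rho> < \<rho>' \<Longrightarrow> Qf \<rho> < Qf \<rho>'"
proof -
  assume r: "0 \<le> \<rho>" "\<rho> < \<rho>'"
  have "continuous_on {\<rho>..\<rho>'} Qf" by (rule continuous_on_subset[OF continuous_on_Q]) (use r in auto)
  moreover have "\<exists>d. (Qf has_real_derivative d) (at x) \<and> 0 < d" if "\<rho> < x" for x
    using DERIV_Q[of x] P'_pos[of x] denominator_pos[of x] r that by (auto intro!: exI)
  ultimately show "Qf \<rho> < Qf \<rho>'"
    using DERIV_pos_imp_increasing_open[OF r(2), of Qf] by blast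
qed

lemma Q_mono: "\<rho> \<le> \<rho>' \<Longrightarrow> Qf \<rho> \<le> Qf \<rho>'"
  using Q_strict_mono[of \<rho> \<rho>'] Q_strict_mono[of 0 \<rho>'] Q_nonpos[of \<rho>] Q_nonpos[of \<rho>'] Q_0
  by (cases "\<rho> = \<rho>'"; cases "0 \<le> \<rho>"; cases "0 < \<rho>'") auto

lemma Q_inj: "inj_on Qf {0..}"
  using Q_strict_mono by (intro linorder_inj_onI) (auto dest: less_imp_neq)

lemma y_max_eq: "ymax = (SUP \<rho>. ereal (Qf \<rho>))"
proof -
  have "((\<lambda>\<rho>. ereal (Qf \<rho>)) \<longlongrightarrow> (SUP \<rho>. ereal (Qf \<rho>))) at_top"
  proof (rule order_tendstoI)
    fix a assume "a < (SUP \<rho>. ereal (Qf \<rho>))"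
    then obtain \<rho> where "a < ereal (Qf \<rho>)" by (auto simp: less_SUP_iff)
    then show "\<forall>\<^sub>F x in at_top. a < ereal (Qf x)"
      using Q_mono by (intro eventually_at_top_linorderI[of \<rho>]) (auto intro: less_le_trans)
  next
    fix a assume "(SUP \<rho>. ereal (Qf \<rho>)) < a"
    moreover have "ereal (Qf x) \<le> (SUP \<rho>. ereal (Qf \<rho>))" for x by (rule SUP_upper) simp
    ultimately show "\<forall>\<^sub>F x in at_top. ereal (Qf x) < a"
      using le_less_trans by (intro always_eventually allI) blast
  qed
  then show ?thesis unfolding y_max_def by (rule tendsto_Lim[rotated]) simp
qed

lemma below_y_max: "ereal x < ymax \<Longrightarrow> \<exists>\<rho>>0. x < Qf \<rho>"
proof -
  assume "ereal x < ymax"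
  then obtain \<rho> where "x < Qf \<rho>" by (auto simp: y_max_eq less_SUP_iff)
  then have "x < Qf (max 1 \<rho>)" using Q_mono[of \<rho> "max 1 \<rho>"] by simp
  then show ?thesis by (intro exI[of _ "max 1 \<rho>"]) auto
qed

lemma Q_less_y_max: "0 \<le> \<rho> \<Longrightarrow> ereal (Qf \<rho>) < ymax"
proof -
  assume "0 \<le> \<rho>"
  then have "ereal (Qf \<rho>) < ereal (Qf (\<rho> + 1))" using Q_strict_mono[of \<rho> "\<rho> + 1"] by simp
  also have "\<dots> \<le> ymax" unfolding y_max_eq by (rule SUP_upper) simp
  finally show ?thesis .
qed

section \<open>The inverse function \<open>g\<close> and the pressure as a function of
  \<open>y\<close>\<close>

lemma g_nonpos: "x \<le> 0 \<Longrightarrow> gf x = 0"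
  by (simp add: g_def)

lemma g_Q: "0 \<le> \<rho> \<Longrightarrow> gf (Qf \<rho>) = \<rho>"
  using Q_strict_mono[of 0 \<rho>] Q_0 the_inv_into_f_f[OF Q_inj, of \<rho>]
  by (cases "\<rho> = 0") (auto simp: g_def)

lemma Q_surj:
  assumes "0 \<le> x" "ereal x < ymax"
  obtains \<rho> where "0 \<le> \<rho>" "Qf \<rho> = x" "gf x = \<rho>"
proof -
  obtain b where b: "0 < b" "x < Qf b" using below_y_max[OF assms(2)] by blast
  then obtain \<rho> where "0 \<le> \<rho>" "Qf \<rho> = x"
    using IVT'[of Qf 0 x b] continuous_on_Q[of b] assms(1) Q_0 by auto
  then show ?thesis using that g_Q by blast
qed

lemma Q_g: "0 \<le> x \<Longrightarrow> ereal x < ymax \<Longrightarrow> Qf (gf x) = x"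
  using Q_surj by metis

lemma g_nonneg: "ereal x < ymax \<Longrightarrow> 0 \<le> gf x"
  using Q_surj[of x] g_nonpos[of x] by (metis linear order_refl)

lemma g_pos: "0 < x \<Longrightarrow> ereal x < ymax \<Longrightarrow> 0 < gf x"
  using Q_g[of x] g_nonneg[of x] Q_0 by (cases "gf x = 0") auto

lemma g_mono:
  assumes "x \<le> z" "ereal z < ymax"
  shows "gf x \<le> gf z"
proof (cases "x \<le> 0")
  case True
  then show ?thesis using g_nonpos g_nonneg assms by simp
next
  case False
  have x: "ereal x < ymax" using assms by (meson ereal_less_eq(3) le_less_trans)
  have "\<not> gf z < gf x"
    using Q_strict_mono[of "gf z" "gf x"] g_nonneg[OF assms(2)] Q_g[OF _ x] Q_g[OF _ assms(2)] False assms(1) by auto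
  then show ?thesis by simp
qed

text \<open>On a compact interval whose image reaches beyond \<open>x\<close>, the inverse of a
  continuous injection is continuous; composing with \<open>max 0\<close> adds the vacuum
  half-line.\<close>

lemma continuous_on_g:
  assumes "ereal x < ymax"
  shows "continuous_on {..x} gf"
proof -
  obtain b where b: "0 < b" "x < Qf b" using below_y_max[OF assms] by blast
  have "continuous_on (Qf ` {0..b}) gf"
    by (rule continuous_on_inv[OF continuous_on_Q]) (auto simp: g_Q)
  moreover have "{0..max 0 x} \<subseteq> Qf ` {0..b}"
  proof
    fix u assume u: "u \<in> {0..max 0 x}"
    then have "u \<le> Qf b" using b Q_strict_mono[of 0 b] Q_0 by auto
    then obtain \<rho> where "0 \<le> \<rho>" "\<rho> \<le> b" "Qf \<rho> = u"
      using IVT'[of Qf 0 u b] continuous_on_Q[of b] u b Q_0 by auto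
    then show "u \<in> Qf ` {0..b}" by auto
  qed
  ultimately have "continuous_on {0..max 0 x} gf" by (rule continuous_on_subset)
  then have "continuous_on {..x} (\<lambda>u. gf (max 0 u))"
    by (rule continuous_on_compose2) (auto intro!: continuous_intros)
  then show ?thesis
    by (rule continuous_on_eq) (auto simp: max_def g_nonpos)
qed

lemma isCont_g:
  assumes "ereal x < ymax"
  shows "isCont gf x"
proof -
  obtain b where "0 < b" "x < Qf b" using below_y_max[OF assms] by blast
  moreover from this have "ereal (Qf b) < ymax" by (intro Q_less_y_max) simp
  ultimately show ?thesis
    using continuous_on_interior[OF continuous_on_g] by auto
qed

lemma DERIV_g:
  assumes "0 < x" "ereal x < ymax"
  shows "(gf has_real_derivative (gf x + active (gf x)) / P' (gf x)) (at x)"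
proof -
  obtain b where b: "0 < b" "x < Qf b" using below_y_max[OF assms(2)] by blast
  have gp: "0 < gf x" by (rule g_pos[OF assms])
  have "(gf has_real_derivative inverse (P' (gf x) / (gf x + active (gf x)))) (at x)"
  proof (rule DERIV_inverse_function[OF DERIV_Q[OF gp] _ assms(1) b(2) _ isCont_g[OF assms(2)]])
    show "P' (gf x) / (gf x + active (gf x)) \<noteq> 0"
      using P'_pos[OF gp] denominator_pos[OF gp] by simp
    fix y assume y: "0 < y" "y < Qf b"
    then have "ereal y < ymax"
      unfolding y_max_eq by (intro less_le_trans[OF _ SUP_upper[of b]]) auto
    then show "Qf (gf y) = y" using Q_g y by simp
  qed
  then show ?thesis by simp
qed

lemma continuous_on_active_g:
  "ereal x < ymax \<Longrightarrow> continuous_on {..x} (\<lambda>u. active (gf u))"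
  by (rule continuous_on_compose2[OF continuous_on_active continuous_on_g])
    (auto intro!: g_nonneg elim: le_less_trans[rotated])

lemma continuous_on_P_g:
  "ereal x < ymax \<Longrightarrow> continuous_on {..x} (\<lambda>u. P (gf u))"
  by (rule continuous_on_compose2[OF continuous_on_P continuous_on_g])
    (auto intro!: g_nonneg elim: le_less_trans[rotated])

text \<open>For positive argument the chain rule multiplies \<open>P'\<close> with a slope of
  \<open>g\<close> that has \<open>P'\<close> in its denominator. What remains is continuous at
  \<open>0\<close>, although \<open>g\<close> may fail to be differentiable there. The fundamental
  theorem with \<open>0\<close> as exceptional point writes \<open>P (gf u)\<close> as an integral
  of this continuous function, which yields the derivative at \<open>0\<close> too.\<close>

lemma DERIV_P_g:
  assumes "ereal x < ymax"
  shows "((\<lambda>u. P (gf u)) has_real_derivative gf x + active (gf x)) (at x)"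
proof -
  define h where "h u = gf u + active (gf u)" for u
  obtain b where b: "0 < b" "x < Qf b" using below_y_max[OF assms] by blast
  have bm: "ereal (Qf b) < ymax" using b by (intro Q_less_y_max) simp
  \<comment> \<open>The base point lies strictly below both \<open>x\<close> and the exceptional
    point \<open>0\<close>, so \<open>x\<close> is interior to the interval.\<close>
  define a where "a = min x 0 - 1"
  have h: "continuous_on {a..Qf b} h"
    unfolding h_def
    by (intro continuous_intros continuous_on_subset[OF continuous_on_active_g[OF bm]]
        continuous_on_subset[OF continuous_on_g[OF bm]]) auto
  have deriv: "((\<lambda>u. P (gf u)) has_real_derivative h u) (at u)" if "u \<noteq> 0" "u < Qf b" for u
  proof (cases "0 < u")
    case True
    have um: "ereal u < ymax" using that bm by (meson ereal_less_eq(3) le_less_trans less_imp_le)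
    have "((\<lambda>u. P (gf u)) has_real_derivative P' (gf u) * ((gf u + active (gf u)) / P' (gf u))) (at u)"
      by (rule DERIV_chain2[OF DERIV_P[OF g_pos[OF True um]] DERIV_g[OF True um]])
    then show ?thesis using P'_pos[OF g_pos[OF True um]] by (simp add: h_def)
  next
    case False
    have "((\<lambda>_. P 0) has_real_derivative h u) (at u)"
      using False by (simp add: h_def g_nonpos active_0)
    moreover have "u \<in> {..<0}" using that False by simp
    ultimately show ?thesis
      by (rule has_field_derivative_transform_within_open[OF _ open_lessThan]) (simp add: g_nonpos)
  qed
  have eq: "P (gf u) = P (gf a) + integral {a..u} h" if u: "a \<le> u" "u < Qf b" for u
  proof -
    have "(h has_integral P (gf u) - P (gf a)) {a..u}"
    proof (rule fundamental_theorem_of_calculus_interior_strong[of "{0}" a u "\<lambda>u. P (gf u)"])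
      show "((\<lambda>u. P (gf u)) has_vector_derivative h t) (at t)" if "t \<in> {a<..<u} - {0}" for t
        using deriv[of t] that u by (simp add: has_real_derivative_iff_has_vector_derivative)
      show "continuous_on {a..u} (\<lambda>u. P (gf u))"
        by (rule continuous_on_subset[OF continuous_on_P_g[OF bm]]) (use u in auto)
    qed (use u in auto)
    then show ?thesis by (simp add: integral_unique)
  qed
  have "((\<lambda>u. P (gf a) + integral {a..u} h) has_real_derivative h x) (at x within {a..Qf b})"
    using integral_has_real_derivative[OF h, of x] b by (auto intro!: derivative_eq_intros simp: a_def)
  moreover have "at x within {a..Qf b} = at x"
    using b by (intro at_within_interior) (simp add: a_def)
  ultimately have "((\<lambda>u. P (gf a) + integral {a..u} h) has_real_derivative h x) (at x)" by simp
  moreover have "x \<in> {a<..<Qf b}" using b by (simp add: a_def)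
  ultimately show ?thesis
    unfolding h_def[of x, symmetric]
    by (rule has_field_derivative_transform_within_open[OF _ open_greaterThanLessThan])
      (rule eq[symmetric], simp_all)
qed

text \<open>\<open>Q \<rho> \<le> c n \<rho> powr (1 / n)\<close> near \<open>0\<close>, so \<open>g x\<close> is at least of order \<open>x powr n\<close>.\<close>

lemma g_lower_bound:
  assumes c: "0 < c" "0 < \<rho>0" "0 < n" "n < 3"
    and P'_bound: "\<And>\<rho>. 0 < \<rho> \<Longrightarrow> \<rho> < \<rho>0 \<Longrightarrow> P' \<rho> \<le> c * \<rho> powr (1 / n)"
    and y0: "0 < y0" "ereal y0 < ymax"
  obtains K q where "0 < K" "1 < q" "q < 3" "\<And>x. 0 < x \<Longrightarrow> x \<le> y0 \<Longrightarrow> K * x powr q \<le> gf x"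
proof -
  have Q_le: "Qf \<rho> \<le> c * n * \<rho> powr (1 / n)" if \<rho>: "0 \<le> \<rho>" "\<rho> < \<rho>0" for \<rho>
  proof -
    have "Qf \<rho> - c * n * \<rho> powr (1 / n) \<le> Qf 0 - c * n * 0 powr (1 / n)"
    proof (rule nonincreasing_Icc[where f = "\<lambda>\<rho>. Qf \<rho> - c * n * \<rho> powr (1 / n)", OF _ _ \<rho>(1)])
      show "continuous_on {0..\<rho>} (\<lambda>\<rho>. Qf \<rho> - c * n * \<rho> powr (1 / n))"
        using c by (intro continuous_intros continuous_on_Q continuous_on_powr') auto
    next
      fix s assume s: "0 < s" "s < \<rho>"
      have "P' s / (s + active s) \<le> (c * s powr (1 / n)) / s"
        using P'_bound[of s] s \<rho> active_nonneg[of s] P'_pos[of s] by (intro frac_le) auto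
      also have "\<dots> = c * s powr (1 / n - 1)" using s by (simp add: powr_diff)
      finally have "P' s / (s + active s) - c * n * (1 / n * s powr (1 / n - 1)) \<le> 0"
        using c by simp
      moreover have "((\<lambda>\<rho>. Qf \<rho> - c * n * \<rho> powr (1 / n)) has_real_derivative
          P' s / (s + active s) - c * n * (1 / n * s powr (1 / n - 1))) (at s)"
        using s by (intro DERIV_diff DERIV_Q DERIV_cmult has_real_derivative_powr) auto
      ultimately show "\<exists>d. ((\<lambda>\<rho>. Qf \<rho> - c * n * \<rho> powr (1 / n)) has_real_derivative d) (at s) \<and> d \<le> 0"
        by blast
    qed
    then show ?thesis by (simp add: Q_0)
  qed
  \<comment> \<open>The decay argument wants an exponent strictly between \<open>1\<close> and
    \<open>3\<close>, while \<open>n\<close> may be at most \<open>1\<close>. Since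
    \<open>x \<le> y0\<close>, raising the exponent costs only the factor
    \<open>y0 powr (n - q)\<close>. The second entry of \<open>K\<close> covers arguments whose
    density is at least \<open>\<rho>0\<close>.\<close>
  define q where "q = max n 2"
  define K where "K = min ((1 / (c * n)) powr n * y0 powr (n - q)) (\<rho>0 / 2 * y0 powr (- q))"
  have "0 < K" using c y0 by (simp add: K_def)
  moreover have "1 < q" "q < 3" "n \<le> q" using c by (auto simp: q_def)
  moreover have "K * x powr q \<le> gf x" if x: "0 < x" "x \<le> y0" for x
  proof (cases "gf x < \<rho>0")
    case True
    have xm: "ereal x < ymax" using x y0 by (meson ereal_less_eq(3) le_less_trans)
    have gx: "0 < gf x" by (rule g_pos[OF x(1) xm])
    have "x \<le> c * n * gf x powr (1 / n)" using Q_le[of "gf x"] gx True Q_g[OF _ xm] x by simp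
    then have "x / (c * n) \<le> gf x powr (1 / n)" using c by (simp add: pos_divide_le_eq mult.commute)
    then have "(x / (c * n)) powr n \<le> (gf x powr (1 / n)) powr n"
      using x c by (intro powr_mono2) auto
    also have "\<dots> = gf x" using c gx by (simp add: powr_powr)
    finally have "(1 / (c * n)) powr n * x powr n \<le> gf x"
      using x c by (simp add: powr_mult[symmetric])
    moreover have "y0 powr (n - q) * x powr q \<le> x powr n"
    proof -
      have "y0 powr (n - q) \<le> x powr (n - q)"
        using x y0 \<open>n \<le> q\<close> by (intro powr_mono2') auto
      then have "y0 powr (n - q) * x powr q \<le> x powr (n - q) * x powr q"
        by (intro mult_right_mono) auto
      then show ?thesis using x by (simp flip: powr_add)
    qed
    then have "(1 / (c * n)) powr n * (y0 powr (n - q) * x powr q) \<le> (1 / (c * n)) powr n * x powr n"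
      by (intro mult_left_mono) auto
    moreover have "K * x powr q \<le> (1 / (c * n)) powr n * y0 powr (n - q) * x powr q"
      unfolding K_def by (intro mult_right_mono) auto
    ultimately show ?thesis by (simp add: mult.assoc)
  next
    case False
    have "K * x powr q \<le> \<rho>0 / 2 * y0 powr (- q) * x powr q"
      unfolding K_def by (intro mult_right_mono) auto
    also have "\<dots> \<le> \<rho>0 / 2 * y0 powr (- q) * y0 powr q"
      using x c \<open>1 < q\<close> by (intro mult_left_mono powr_mono2) auto
    also have "\<dots> = \<rho>0 / 2" using y0 by (simp add: powr_minus)
    finally show ?thesis using False c by simp
  qed
  ultimately show ?thesis using that by blast
qed

end

subsection \<open>The static solutions\<close>

locale stellar_model = equation_of_state +
  fixes y0 :: real
  assumes y0_pos: "0 < y0" and y0_less: "ereal y0 < y_max M P P'"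
begin

lemma less_y_max: "x \<le> y0 \<Longrightarrow> ereal x < ymax"
  using y0_less by (meson ereal_less_eq(3) le_less_trans)

lemma continuous_on_g': "continuous_on {0<..y0} (\<lambda>x. (gf x + active (gf x)) / P' (gf x))"
proof (intro continuous_intros ballI)
  show "continuous_on {0<..y0} gf" "continuous_on {0<..y0} (\<lambda>x. active (gf x))"
    using continuous_on_g[OF y0_less] continuous_on_active_g[OF y0_less]
    by (auto elim!: continuous_on_subset)
  then show "continuous_on {0<..y0} (\<lambda>x. P' (gf x))"
    by (intro continuous_on_compose2[OF continuous_on_P']) (auto intro!: g_nonneg less_y_max)
  show "P' (gf x) \<noteq> 0" if "x \<in> {0<..y0}" for x
    using P'_pos[OF g_pos[OF _ less_y_max]] that by (metis greaterThanAtMost_iff less_irrefl)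
qed

text \<open>By \<open>DERIV_P_g\<close> the pressure has a bounded slope across the vacuum value, so
  \<open>e\<close> may have any sign here, unlike for the density.\<close>

lemma active_g_lipschitz:
  "\<exists>L\<ge>0. \<forall>x\<in>{e..y0}. \<forall>z\<in>{e..y0}. \<bar>active (gf x) - active (gf z)\<bar> \<le> L * \<bar>x - z\<bar>"
proof (cases "M = EE")
  case True
  have "continuous_on {e..y0} (\<lambda>x. gf x + active (gf x))"
    using continuous_on_g[OF y0_less] continuous_on_active_g[OF y0_less]
    by (intro continuous_intros) (auto elim!: continuous_on_subset)
  then have "\<exists>L\<ge>0. \<forall>x\<in>{e..y0}. \<forall>z\<in>{e..y0}. \<bar>P (gf x) - P (gf z)\<bar> \<le> L * \<bar>x - z\<bar>"
    using DERIV_P_g less_y_max by (intro C1_lipschitz[of e y0 "\<lambda>x. P (gf x)"]) auto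
  moreover have "active s = P s" for s unfolding active_def using True by simp
  ultimately show ?thesis by simp
next
  case False
  then have "active s = 0" for s unfolding active_def by simp
  then show ?thesis by auto
qed

end

sublocale stellar_model \<subseteq> structure_equation "g M P P'" "\<lambda>x. active (g M P P' x)" y0
  coupling
proof
  show "0 \<le> coupling" "coupling \<le> 1" by (simp_all add: coupling_def)
  show "continuous_on {..y0} gf" by (rule continuous_on_g[OF y0_less])
  show "continuous_on {..y0} (\<lambda>x. active (gf x))" by (rule continuous_on_active_g[OF y0_less])
  show "gf x = 0" "active (gf x) = 0" if "x \<le> 0" for x
    using that by (simp_all add: g_nonpos active_0)
  show "0 < gf x" if "0 < x" "x \<le> y0" for x
    using that by (intro g_pos less_y_max)
  show "gf x \<le> gf z" if "x \<le> z" "z \<le> y0" for x z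
    using that by (intro g_mono less_y_max)
  show "active (gf x) \<le> active (gf z)" if "x \<le> z" "z \<le> y0" for x z
    using that by (intro active_mono g_mono g_nonneg less_y_max) auto
  show "\<exists>L\<ge>0. \<forall>x\<in>{e..y0}. \<forall>z\<in>{e..y0}. \<bar>gf x - gf z\<bar> \<le> L * \<bar>x - z\<bar>" if "0 < e" for e
  proof (rule C1_lipschitz)
    show "continuous_on {e..y0} (\<lambda>x. (gf x + active (gf x)) / P' (gf x))"
      by (rule continuous_on_subset[OF continuous_on_g']) (use that in auto)
    show "(gf has_real_derivative (gf x + active (gf x)) / P' (gf x)) (at x)" if "x \<in> {e..y0}" for x
      using that \<open>0 < e\<close> by (intro DERIV_g less_y_max) auto
  qed
  show "\<exists>L\<ge>0. \<forall>x\<in>{e..y0}. \<forall>z\<in>{e..y0}. \<bar>active (gf x) - active (gf z)\<bar> \<le> L * \<bar>x - z\<bar>" for e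
    by (rule active_g_lipschitz)
qed (auto intro: y0_pos)

context stellar_model
begin

section \<open>The reduced equation as an instance of the structure equation\<close>

lemma mass_eq: "mass M P P' y r = ms y r"
  by (simp add: mass_def ms_def)

lemma reduced_rhs_eq: "reduced_rhs M P P' y r = rhs y r"
  unfolding rhs_def \<phi>_def mass_eq[symmetric] unfolding active_def coupling_def
  by (cases M; cases "r = 0") simp_all

text \<open>Nothing is assumed about regularity of \<open>y\<close>; if the integrand is not
  integrable, the integral is \<open>0\<close> by convention.\<close>

lemma mass_nonneg:
  assumes "\<And>s. 0 \<le> s \<Longrightarrow> ereal (y s) < ymax"
  shows "0 \<le> mass M P P' y r"
proof (cases "(\<lambda>s. s\<^sup>2 * gf (y s)) integrable_on {0..r}")
  case True
  then have "0 \<le> integral {0..r} (\<lambda>s. s\<^sup>2 * gf (y s))"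
    using assms by (intro integral_nonneg) (auto intro!: mult_nonneg_nonneg g_nonneg)
  then show ?thesis by (simp add: mass_def)
qed (simp add: mass_def not_integrable_integral)

text \<open>A reduced solution is only required to stay below \<open>y_max\<close>. The bound by
  \<open>y0\<close> follows from the sign of its derivative, for which nonnegative mass and pressure
  and a positive denominator suffice.\<close>

lemma reduced_solution_iff_star: "reduced_solution M P P' y0 y \<longleftrightarrow> star y"
proof
  assume y: "reduced_solution M P P' y0 y"
  have yd: "(y has_real_derivative rhs y r) (at r within {0..})" if "0 \<le> r" for r
    using y that by (simp add: reduced_solution_def C1_halfline_def reduced_rhs_eq)
  have ym: "ereal (y r) < ymax" if "0 \<le> r" for r
    using y that by (simp add: reduced_solution_def)
  have \<phi>_pos: "0 < \<phi> y r" if "0 < r" for r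
    using y that unfolding reduced_solution_def \<phi>_def mass_eq[symmetric] unfolding coupling_def
    by (cases M) auto
  have "y r \<le> y 0" if r: "0 \<le> r" for r
  proof (rule nonincreasing_Icc[where f = y, OF _ _ r])
    fix x :: real assume x: "0 < x"
    have "0 \<le> ms y x / x\<^sup>2 + 4 * pi * x * active (gf (y x))"
    proof -
      have "0 \<le> active (gf (y x))" using x by (intro active_nonneg g_nonneg ym) simp
      then show ?thesis using mass_nonneg[of y x, OF ym] x by (simp add: mass_eq)
    qed
    then have "rhs y x \<le> 0" using \<phi>_pos[OF x] by (simp add: rhs_def)
    then show "\<exists>d. (y has_real_derivative d) (at x) \<and> d \<le> 0"
      using yd[of x] x at_within_halfline[OF x] by auto
  next
    have "continuous_on {0..} y" using yd by (auto intro: DERIV_continuous_on)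
    then show "continuous_on {0..r} y" by (rule continuous_on_subset) auto
  qed
  then show "star y"
    using y yd \<phi>_pos by (simp add: star_def reduced_solution_def)
next
  assume y: "star y"
  have "2 * mass M P P' y r < r" if "M = EE" "0 < r" for r
    using star_\<phi>_pos[OF y, of r] that unfolding \<phi>_def mass_eq[symmetric] unfolding coupling_def
    by simp
  moreover have "ereal (y r) < ymax" if "0 \<le> r" for r
    using y that by (intro less_y_max) (simp add: star_def)
  moreover have "continuous_on {0..} (reduced_rhs M P P' y)"
    using continuous_on_rhs[OF y] by (simp add: reduced_rhs_eq[abs_def])
  ultimately show "reduced_solution M P P' y0 y"
    using y unfolding reduced_solution_def C1_halfline_def reduced_rhs_eq star_def by blast
qed

section \<open>Matter and field equations, regularity of the density\<close>

lemma DERIV_pressure: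
  assumes "star y" "0 \<le> r"
  shows "((\<lambda>r. P (gf (y r))) has_real_derivative (gf (y r) + active (gf (y r))) * rhs y r) (at r within {0..})"
  using assms by (intro DERIV_chain2[OF DERIV_P_g]) (auto simp: star_def intro: less_y_max)

lemma rhs_0: "rhs y 0 = 0"
  by (simp add: rhs_def)

text \<open>The derivative of the pressure is \<open>(\<rho> + active \<rho>) y'\<close> and that of
  the potential is \<open>- y'\<close>, so the two gradients cancel. The choice of
  \<open>active\<close> makes this the equation of either model.\<close>

lemma hydrostatic:
  assumes y: "star y"
  shows "C1_on UNIV (\<lambda>x. P (gf (y (norm x))))" "C1_on UNIV (\<lambda>x. l - y (norm x))"
    "gradient (\<lambda>x. P (gf (y (norm x)))) x +
      (gf (y (norm x)) + active (gf (y (norm x)))) *\<^sub>R gradient (\<lambda>x. l - y (norm x)) x = 0"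
proof -
  define p' where "p' r = (gf (y r) + active (gf (y r))) * rhs y r" for r
  have ad: "admissible y" by (rule star_admissible[OF y])
  have "continuous_on {0..} p'"
    unfolding p'_def
    by (intro continuous_intros continuous_on_rhs[OF y] continuous_on_G_admissible[OF ad]
        continuous_on_H_admissible[OF ad])
  note p = DERIV_pressure[OF y, folded p'_def] this
  have "continuous_on {0..} (\<lambda>r. - rhs y r)" by (intro continuous_intros continuous_on_rhs[OF y])
  moreover have "((\<lambda>r. l - y r) has_real_derivative - rhs y r) (at r within {0..})" if "0 \<le> r" for r
    using y that by (auto intro!: derivative_eq_intros simp: star_def)
  ultimately have
    "C1_on UNIV (\<lambda>x. l - y (norm x))"
    "gradient (\<lambda>x. l - y (norm x)) x = (- rhs y (norm x) / norm x) *\<^sub>R x" for x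
    using C1_on_radial[of "{0..}" "\<lambda>r. l - y r" "\<lambda>r. - rhs y r" UNIV]
      gradient_radial[of "{0..}" "\<lambda>r. l - y r" "\<lambda>r. - rhs y r" UNIV x] by (auto simp: rhs_0)
  moreover have
    "C1_on UNIV (\<lambda>x. P (gf (y (norm x))))"
    "gradient (\<lambda>x. P (gf (y (norm x)))) x = (p' (norm x) / norm x) *\<^sub>R x" for x
    using C1_on_radial[of "{0..}" "\<lambda>r. P (gf (y r))" p' UNIV] p
      gradient_radial[of "{0..}" "\<lambda>r. P (gf (y r))" p' UNIV x] by (auto simp: rhs_0 p'_def)
  ultimately show "C1_on UNIV (\<lambda>x. P (gf (y (norm x))))" "C1_on UNIV (\<lambda>x. l - y (norm x))"
    "gradient (\<lambda>x. P (gf (y (norm x)))) x +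
      (gf (y (norm x)) + active (gf (y (norm x)))) *\<^sub>R gradient (\<lambda>x. l - y (norm x)) x = 0"
    by (simp_all add: p'_def)
qed

lemma static_Euler_Poisson_star:
  assumes y: "star y" and M: "M = EP" and l: "(y \<longlongrightarrow> l) at_top"
  shows "static_Euler_Poisson P (\<lambda>x. gf (y (norm x))) (\<lambda>x. P (gf (y (norm x)))) (\<lambda>x. l - y (norm x))"
proof -
  \<comment> \<open>This is \<open>r a'\<close> for \<open>a = mean_density y\<close>, so
    \<open>3 * a + b\<close> collapses to the right hand side of the Poisson equation.\<close>
  define b where "b r = 4 * pi * gf (y r) - 3 * mean_density y r" for r
  have act: "active s = 0" for s unfolding active_def using M by simp
  have cpl: "coupling = 0" unfolding coupling_def using M by simp
  have dU: "((\<lambda>r. l - y r) has_real_derivative mean_density y r * r) (at r within {0..})" if r: "0 \<le> r" for r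
  proof -
    have "mean_density y r * r = 0 - rhs y r"
      unfolding rhs_def \<phi>_def unfolding cpl act by (simp add: mean_density_def power2_eq_square power3_eq_cube)
    moreover have "((\<lambda>r. l - y r) has_real_derivative 0 - rhs y r) (at r within {0..})"
      using y r by (intro DERIV_diff DERIV_const) (simp add: star_def)
    ultimately show ?thesis by simp
  qed
  have "y 0 = y0" using y by (simp add: star_def)
  then have "b 0 = 0" by (simp add: b_def mean_density_def)
  moreover have "continuous_on {0..} b"
    unfolding b_def
    by (intro continuous_intros continuous_on_G_admissible star_admissible continuous_on_mean_density y)
  ultimately have b: "continuous_on {0..} b" "b 0 = 0" by auto
  have da: "(mean_density y has_real_derivative b r / r) (at r)" if "0 < r" for r
    using DERIV_mean_density[OF y that] by (simp add: b_def)
  note radial = dU continuous_on_mean_density[OF y] da b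
  have "laplacian (\<lambda>x. l - y (norm x)) x = 4 * pi * gf (y (norm x))" for x
    using laplacian_radial[of "\<lambda>r. l - y r", OF radial] by (simp add: b_def)
  moreover have "C2_on UNIV (\<lambda>x. l - y (norm x))"
    using C2_on_radial[of "\<lambda>r. l - y r", OF radial] .
  moreover have "((\<lambda>x :: real ^ 3. l - y (norm x)) \<longlongrightarrow> 0) at_infinity"
    using tendsto_diff[OF tendsto_const[of l] filterlim_compose[OF l filterlim_norm_at_top]] by simp
  moreover have "0 \<le> gf (y (norm x))" for x :: "real ^ 3"
    using y by (auto simp: star_def intro!: g_nonneg less_y_max)
  ultimately show ?thesis
    unfolding static_Euler_Poisson_def using hydrostatic(1)[OF y] hydrostatic(2,3)[OF y, where l = l] by (simp add: act)
qed

text \<open>With \<open>exp (- 2 * lam) = \<phi>\<close> and \<open>r * \<phi> = r - 2 * m\<close>,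
  the first field equation is \<open>1 - (r * \<phi>)' = 8 * pi * r\<^sup>2 * \<rho>\<close>, that
  is, the mass formula differentiated. The second is the reduced equation solved for the
  pressure.\<close>

lemma static_Einstein_Euler_star:
  assumes y: "star y" and M: "M = EE" and l: "(y \<longlongrightarrow> l) at_top" and R: "0 < R" "y R = 0"
  defines "lam \<equiv> \<lambda>r. - ln (\<phi> y r) / 2"
  shows "\<And>r. 0 < r \<Longrightarrow> exp (- 2 * lam r) = 1 - 2 * mass M P P' y r / r"
    and "static_Einstein_Euler P (\<lambda>r. gf (y r)) (\<lambda>r. P (gf (y r))) (\<lambda>r. l - y r) lam"
proof -
  have ad: "admissible y" by (rule star_admissible[OF y])
  have pos: "0 < \<phi> y r" if "0 \<le> r" for r by (rule star_\<phi>_pos[OF y that])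
  have act: "active s = P s" for s unfolding active_def using M by simp
  have cpl: "coupling = 1" unfolding coupling_def using M by simp
  have exp_lam: "exp (- 2 * lam r) = \<phi> y r" if "0 \<le> r" for r
    using pos[OF that] by (simp add: lam_def)
  then show "exp (- 2 * lam r) = 1 - 2 * mass M P P' y r / r" if "0 < r" for r
    using that unfolding \<phi>_def mass_eq unfolding cpl by simp
  define lam' where "lam' r = - \<phi>' y r / \<phi> y r / 2" for r
  have "C1_halfline lam lam'"
    unfolding C1_halfline_def lam_def lam'_def
  proof (intro conjI allI impI)
    fix r :: real assume r: "0 \<le> r"
    show "((\<lambda>r. - ln (\<phi> y r) / 2) has_real_derivative - \<phi>' y r / \<phi> y r / 2) (at r within {0..})"
      using pos[OF r] by (auto intro!: derivative_eq_intros DERIV_\<phi>_closed[OF ad r] simp: field_simps)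
  qed (use pos in \<open>auto intro!: continuous_intros continuous_on_\<phi>' continuous_on_\<phi>_closed ad simp: less_imp_neq[symmetric]\<close>)
  moreover have "C1_halfline (\<lambda>r. l - y r) (\<lambda>r. - rhs y r)"
    unfolding C1_halfline_def
  proof (intro conjI allI impI)
    fix r :: real assume "0 \<le> r"
    then have "((\<lambda>r. l - y r) has_real_derivative 0 - rhs y r) (at r within {0..})"
      using y by (intro DERIV_diff DERIV_const) (simp add: star_def)
    then show "((\<lambda>r. l - y r) has_real_derivative - rhs y r) (at r within {0..})" by simp
  qed (intro continuous_intros continuous_on_rhs[OF y])
  moreover have "exp (- 2 * lam r) * (2 * r * lam' r - 1) + 1 = 8 * pi * r\<^sup>2 * gf (y r)" if r: "0 \<le> r" for r
  proof (cases "r = 0")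
    case False
    have "\<phi> y r * (2 * r * lam' r - 1) + 1 = 1 - \<phi> y r - r * \<phi>' y r"
      using pos[OF r] by (simp add: lam'_def field_simps)
    also have "\<dots> = 8 * pi * r\<^sup>2 * gf (y r)"
      using False unfolding \<phi>_def \<phi>'_def unfolding cpl by (simp add: field_simps power2_eq_square)
    finally show ?thesis by (simp only: exp_lam[OF r])
  qed (simp add: lam_def \<phi>_0)
  moreover have "exp (- 2 * lam r) * (2 * r * (- rhs y r) + 1) - 1 = 8 * pi * r\<^sup>2 * P (gf (y r))" if r: "0 \<le> r" for r
  proof (cases "r = 0")
    case False
    have "\<phi> y r * (2 * r * (- rhs y r) + 1) - 1 = 2 * r * (ms y r / r\<^sup>2 + 4 * pi * r * P (gf (y r))) + \<phi> y r - 1"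
      using pos[OF r] unfolding rhs_def unfolding act by (simp add: field_simps)
    also have "\<dots> = 8 * pi * r\<^sup>2 * P (gf (y r))"
      using False unfolding \<phi>_def unfolding cpl by (simp add: field_simps power2_eq_square)
    finally show ?thesis by (simp only: exp_lam[OF r])
  qed (simp add: lam_def \<phi>_0)
  ultimately have fields: "\<exists>\<mu>' lam'. C1_halfline (\<lambda>r. l - y r) \<mu>' \<and> C1_halfline lam lam' \<and>
      (\<forall>r\<ge>0. exp (- 2 * lam r) * (2 * r * lam' r - 1) + 1 = 8 * pi * r\<^sup>2 * gf (y r)) \<and>
      (\<forall>r\<ge>0. exp (- 2 * lam r) * (2 * r * \<mu>' r + 1) - 1 = 8 * pi * r\<^sup>2 * P (gf (y r)))"
    by blast
  have "(lam \<longlongrightarrow> - ln 1 / 2) at_top"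
    unfolding lam_def by (intro tendsto_intros \<phi>_tendsto[OF y R]) auto
  then have lam_lim: "(lam \<longlongrightarrow> 0) at_top" by simp
  have \<mu>_lim: "((\<lambda>r. l - y r) \<longlongrightarrow> 0) at_top"
    using tendsto_diff[OF tendsto_const[of l] l] by simp
  have "0 \<le> gf (y r)" if "0 \<le> r" for r
    using y that by (auto simp: star_def intro!: g_nonneg less_y_max)
  then show "static_Einstein_Euler P (\<lambda>r. gf (y r)) (\<lambda>r. P (gf (y r))) (\<lambda>r. l - y r) lam"
    unfolding static_Einstein_Euler_def
    using hydrostatic(1)[OF y] hydrostatic(2,3)[OF y, where l = l] fields lam_lim \<mu>_lim by (simp add: act add.commute lam_def \<phi>_0)
qed

text \<open>Inside the ball \<open>y\<close> stays strictly positive, where \<open>g\<close> is C1;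
  at the boundary only continuity of \<open>g\<close> remains. Outside \<open>y\<close> is
  nonpositive, so density and, if \<open>P 0 = 0\<close>, pressure vanish.\<close>

lemma density_regular:
  assumes y: "star y" and R: "0 < R" "y R = 0"
  shows "continuous_on UNIV (\<lambda>x :: real ^ 3. gf (y (norm x)))"
    and "C1_on (ball 0 R) (\<lambda>x. gf (y (norm x)))"
    and "closure {x :: real ^ 3. gf (y (norm x)) \<noteq> 0} \<subseteq> cball 0 R"
    and "P 0 = 0 \<Longrightarrow> closure {x :: real ^ 3. P (gf (y (norm x))) \<noteq> 0} \<subseteq> cball 0 R"
proof -
  have ad: "admissible y" by (rule star_admissible[OF y])
  show "continuous_on UNIV (\<lambda>x :: real ^ 3. gf (y (norm x)))"
    by (rule continuous_on_compose2[OF continuous_on_G_admissible[OF ad]]) (auto intro!: continuous_intros)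
  have outside: "gf (y r) = 0" if "R \<le> r" for r
    using star_decreasing[OF y _ that] R by (intro g_nonpos) simp
  have support: "closure {x :: real ^ 3. F (gf (y (norm x))) \<noteq> 0} \<subseteq> cball 0 R" if "F 0 = 0" for F :: "real \<Rightarrow> real"
  proof (intro closure_minimal closed_cball subsetI)
    fix x :: "real ^ 3" assume "x \<in> {x. F (gf (y (norm x))) \<noteq> 0}"
    then have "\<not> R \<le> norm x" using outside[of "norm x"] that by auto
    then show "x \<in> cball 0 R" by simp
  qed
  show "closure {x :: real ^ 3. gf (y (norm x)) \<noteq> 0} \<subseteq> cball 0 R"
    by (rule support[of "\<lambda>s. s"]) simp
  show "closure {x :: real ^ 3. P (gf (y (norm x))) \<noteq> 0} \<subseteq> cball 0 R" if "P 0 = 0"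
    by (rule support[of P, OF that])
  have inside: "y r \<in> {0<..y0}" if "r \<in> {0..<R}" for r
    using star_strictly_decreasing[OF y, of r R] R ad that by (auto simp: admissible_def)
  define d where "d r = (gf (y r) + active (gf (y r))) / P' (gf (y r)) * rhs y r" for r
  show "C1_on (ball 0 R) (\<lambda>x. gf (y (norm x)))"
  proof (rule C1_on_radial[of "{0..<R}" "\<lambda>r. gf (y r)" d])
    show "((\<lambda>r. gf (y r)) has_real_derivative d r) (at r within {0..})" if "r \<in> {0..<R}" for r
      unfolding d_def using inside[OF that] that y
      by (intro DERIV_chain2[OF DERIV_g]) (auto simp: star_def intro: less_y_max)
    have "continuous_on {0..<R} y" "continuous_on {0..<R} (rhs y)"
      using ad continuous_on_rhs[OF y] by (auto simp: admissible_def elim!: continuous_on_subset)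
    then show "continuous_on {0..<R} d"
      unfolding d_def using inside
      by (intro continuous_on_mult continuous_on_compose2[OF continuous_on_g']) auto
  qed (auto simp: d_def rhs_0)
qed

end

lemma case_modelI: "(m = EP \<Longrightarrow> A) \<Longrightarrow> (m = EE \<Longrightarrow> B) \<Longrightarrow> case m of EP \<Rightarrow> A | EE \<Rightarrow> B"
  by (cases m) auto

theorem theorem4p2:
  fixes M :: model
    and P P' :: "real \<Rightarrow> real"
    and c \<rho>0 n y0 :: real
  assumes P_C1: "C1_halfline P P'"
    and P'_pos: "\<And>s. s > 0 \<Longrightarrow> P' s > 0"
    and P_nonneg: "\<And>s. M = EE \<Longrightarrow> s \<ge> 0 \<Longrightarrow> P s \<ge> 0"
    and P_zero: "M = EE \<Longrightarrow> P 0 = 0"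
    and integral_finite: "Q_integrand M P P' integrable_on {0..1}"
    and constants: "c > 0" "\<rho>0 > 0" "0 < n" "n < 3"
    and P'_bound: "\<And>\<rho>. 0 < \<rho> \<Longrightarrow> \<rho> < \<rho>0 \<Longrightarrow> P' \<rho> \<le> c * \<rho> powr (1 / n)"
    and y0: "0 < y0" "ereal y0 < y_max M P P'"
  shows "\<exists>y R y_inf.
    reduced_solution M P P' y0 y \<and>
    (\<forall>z. reduced_solution M P P' y0 z \<longrightarrow> (\<forall>r\<ge>0. z r = y r)) \<and>
    R > 0 \<and> (\<forall>r\<ge>0. y r = 0 \<longleftrightarrow> r = R) \<and>
    (y \<longlongrightarrow> y_inf) at_top \<and>
    (let \<rho> = (\<lambda>r. g M P P' (y r));
         p = (\<lambda>r. P (\<rho> r));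
         V = (\<lambda>r. y_inf - y r);
         \<rho>3 = (\<lambda>x :: real^3. \<rho> (norm x));
         p3 = (\<lambda>x :: real^3. p (norm x));
         V3 = (\<lambda>x :: real^3. V (norm x))
     in (case M of
           EP \<Rightarrow> static_Euler_Poisson P \<rho>3 p3 V3
         | EE \<Rightarrow> (\<exists>lam. (\<forall>r>0. exp (- 2 * lam r) = 1 - 2 * mass M P P' y r / r) \<and>
                       static_Einstein_Euler P \<rho> p V lam)) \<and>
        spherically_symmetric \<rho>3 \<and> spherically_symmetric p3 \<and> spherically_symmetric V3 \<and>
        closure {x. \<rho>3 x \<noteq> 0} \<subseteq> cball 0 R \<and>
        (P 0 = 0 \<longrightarrow> closure {x. p3 x \<noteq> 0} \<subseteq> cball 0 R) \<and>
        y0 = V R - V 0 \<and>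
        continuous_on UNIV \<rho>3 \<and> C1_on (ball 0 R) \<rho>3)"
proof -
  interpret stellar_model M P P' y0
    by unfold_locales (use assms in auto)
  obtain y where y: "star y" using star_exists by blast
  obtain K q where "0 < K" "1 < q" "q < 3" "\<And>x. 0 < x \<Longrightarrow> x \<le> y0 \<Longrightarrow> K * x powr q \<le> gf x"
    using g_lower_bound[OF constants P'_bound y0] by blast
  then obtain R where R: "0 < R" "y R = 0" using star_has_zero[OF y] by blast
  obtain l where l: "(y \<longlongrightarrow> l) at_top" using star_convergent[OF y R] by blast
  have model: "case M of
        EP \<Rightarrow> static_Euler_Poisson P (\<lambda>x. gf (y (norm x))) (\<lambda>x. P (gf (y (norm x)))) (\<lambda>x. l - y (norm x))
      | EE \<Rightarrow> (\<exists>lam. (\<forall>r>0. exp (- 2 * lam r) = 1 - 2 * mass M P P' y r / r) \<and>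
          static_Einstein_Euler P (\<lambda>r. gf (y r)) (\<lambda>r. P (gf (y r))) (\<lambda>r. l - y r) lam)"
  proof (rule case_modelI)
    assume "M = EE"
    note static_Einstein_Euler_star[OF y this l R]
    then show "\<exists>lam. (\<forall>r>0. exp (- 2 * lam r) = 1 - 2 * mass M P P' y r / r) \<and>
        static_Einstein_Euler P (\<lambda>r. gf (y r)) (\<lambda>r. P (gf (y r))) (\<lambda>r. l - y r) lam"
      by (intro exI[of _ "\<lambda>r. - ln (\<phi> y r) / 2"] conjI) blast+
  qed (rule static_Euler_Poisson_star[OF y _ l])
  have zero: "\<forall>r\<ge>0. y r = 0 \<longleftrightarrow> r = R" using star_zero_unique[OF y _ R(2)] R(1) by simp
  have unique: "\<forall>z. reduced_solution M P P' y0 z \<longrightarrow> (\<forall>r\<ge>0. z r = y r)"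
    using star_unique[OF _ y] by (simp add: reduced_solution_iff_star)
  have sol: "reduced_solution M P P' y0 y" using y by (simp add: reduced_solution_iff_star)
  have difference: "y0 = (l - y R) - (l - y 0)" using y R by (simp add: star_def)
  note symmetric = spherically_symmetric_radial[of "\<lambda>r. gf (y r)"]
    spherically_symmetric_radial[of "\<lambda>r. P (gf (y r))"] spherically_symmetric_radial[of "\<lambda>r. l - y r"]
  show ?thesis
    unfolding Let_def
    by (rule exI[of _ y], rule exI[of _ R], rule exI[of _ l])
      (intro conjI impI sol unique R(1) zero l model symmetric density_regular[OF y R] difference)
qed

end
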